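(* If $f\in \mathrm{DA}(B)$, then $$ \|f\|_{\mathrm{DA}(B)}^2=n\,\frac{n!}{\pi^{n+1}}\int_B\frac{(1-|\zeta|^2)^{n-1}}{|\zeta|^{2n}}\,\big|\mathscr{R}_nf(\zeta)\big|^2\,d\zeta. $$
   Context: Fix an integer $n\ge1$. $B$ is the unit ball of $\mathbb{C}^{n+1}$ and $d\zeta$ is Lebesgue measure. The Drury–Arveson space $\mathrm{DA}(B)$ is the space of holomorphic functions $f(\zeta)=\sum_{|\alpha|\ge0}a_\alpha\zeta^\alpha$ on $B$ with $\|f\|_{\mathrm{DA}(B)}^2=\sum_{|\alpha|\ge0}\frac{\alpha!}{|\alpha|!}|a_\alpha|^2<+\infty$. The differential operators $\mathscr{R}_k$ are defined by $\mathscr{R}_0=\mathrm{Id}$ and $\mathscr{R}_k=\big(\mathrm{Id}+\frac{R}{k}\big)\mathscr{R}_{k-1}$ for $k=1,2,\dots$, where $R$ is the radial derivative $Rf(\zeta)=\sum_{j=1}^{n+1}\zeta_j\partial_{\zeta_j}f(\zeta)$. *)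

theory Defs
  imports "HOL-Complex_Analysis.Complex_Analysis"
begin

type_synonym 'm multi_index = "'m \<Rightarrow> nat"

definition mi_deg :: "'m::finite multi_index \<Rightarrow> nat" where
  "mi_deg \<alpha> = (\<Sum>i\<in>UNIV. \<alpha> i)"

definition mi_fact :: "'m::finite multi_index \<Rightarrow> real" where
  "mi_fact \<alpha> = (\<Prod>i\<in>UNIV. fact (\<alpha> i))"

definition mi_power :: "complex ^ 'm \<Rightarrow> 'm::finite multi_index \<Rightarrow> complex" where
  "mi_power \<zeta> \<alpha> = (\<Prod>i\<in>UNIV. (\<zeta> $ i) ^ \<alpha> i)"

(* Holomorphy in several variables: Frechet differentiability at every point with a
   complex-linear derivative. Intended for open S. *)
definition holomorphic_vec_on :: "(complex ^ 'm::finite \<Rightarrow> complex) \<Rightarrow> (complex ^ 'm) set \<Rightarrow> bool" where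
  "holomorphic_vec_on f S \<longleftrightarrow>
     (\<forall>\<zeta>\<in>S. \<exists>L. (f has_derivative L) (at \<zeta>) \<and> (\<forall>c v. L (c *s v) = c * L v))"

definition has_power_series :: "(complex ^ 'm::finite \<Rightarrow> complex) \<Rightarrow> ('m multi_index \<Rightarrow> complex) \<Rightarrow> bool" where
  "has_power_series f a \<longleftrightarrow>
     (\<forall>\<zeta>\<in>ball 0 1. ((\<lambda>\<alpha>. a \<alpha> * mi_power \<zeta> \<alpha>) has_sum f \<zeta>) UNIV)"

(* The coefficients of a convergent power series on the ball are unique. *)
definition coeffs_of :: "(complex ^ 'm::finite \<Rightarrow> complex) \<Rightarrow> 'm multi_index \<Rightarrow> complex" where
  "coeffs_of f = (THE a. has_power_series f a)"

definition DA_term :: "(complex ^ 'm::finite \<Rightarrow> complex) \<Rightarrow> 'm multi_index \<Rightarrow> real" where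
  "DA_term f \<alpha> = mi_fact \<alpha> / fact (mi_deg \<alpha>) * (cmod (coeffs_of f \<alpha>))\<^sup>2"

(* Elements are total functions; only their values on the unit ball matter. *)
definition DA_space :: "(complex ^ 'm::finite \<Rightarrow> complex) set" where
  "DA_space = {f. holomorphic_vec_on f (ball 0 1) \<and> (\<exists>a. has_power_series f a) \<and>
     DA_term f summable_on UNIV}"

definition DA_norm :: "(complex ^ 'm::finite \<Rightarrow> complex) \<Rightarrow> real" where
  "DA_norm f = sqrt (\<Sum>\<^sub>\<infinity>\<alpha>. DA_term f \<alpha>)"

definition partial_deriv :: "'m::finite \<Rightarrow> (complex ^ 'm \<Rightarrow> complex) \<Rightarrow> complex ^ 'm \<Rightarrow> complex" where
  "partial_deriv j f \<zeta> = deriv (\<lambda>w. f (\<chi> i. if i = j then w else \<zeta> $ i)) (\<zeta> $ j)"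

definition radial_deriv :: "(complex ^ 'm::finite \<Rightarrow> complex) \<Rightarrow> complex ^ 'm \<Rightarrow> complex" where
  "radial_deriv f \<zeta> = (\<Sum>j\<in>UNIV. \<zeta> $ j * partial_deriv j f \<zeta>)"

primrec radial_op :: "nat \<Rightarrow> (complex ^ 'm::finite \<Rightarrow> complex) \<Rightarrow> complex ^ 'm \<Rightarrow> complex" where
  "radial_op 0 f = f"
| "radial_op (Suc k) f =
     (\<lambda>\<zeta>. radial_op k f \<zeta> + radial_deriv (radial_op k f) \<zeta> / of_nat (Suc k))"

end

theory Submission
  imports Defs
begin

text \<open>
  Write \<open>f = \<Sum> a\<^sub>\<alpha> \<zeta>\<^sup>\<alpha>\<close> and \<open>m = |\<alpha>|\<close>. The radial derivative multiplies the coefficient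
  \<open>a\<^sub>\<alpha>\<close> by \<open>m\<close>, so the operator of order \<open>n\<close> multiplies it by
  \<open>\<Prod>\<^bsub>k=1..n\<^esub> (1 + m/k) = (m + n choose n)\<close> (\<open>has_power_series_radial_op\<close>). The weight
  \<open>(1 - |\<zeta>|\<^sup>2)\<^sup>n\<^sup>-\<^sup>1 / |\<zeta>|\<^sup>2\<^sup>n\<close> is invariant under rotation of each single coordinate, so distinct
  monomials are orthogonal for it, and the integral of \<open>|\<Sum> c\<^sub>\<alpha> \<zeta>\<^sup>\<alpha>|\<^sup>2\<close> equals the sum of
  \<open>|c\<^sub>\<alpha>|\<^sup>2\<close> times the weighted moment of \<open>|\<zeta>\<^sup>\<alpha>|\<^sup>2\<close> (\<open>nn_integral_power_series\<close>). That moment is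
  \<open>\<pi>\<^sup>n\<^sup>+\<^sup>1 \<alpha>! m! (n - 1)! / ((m + n)!)\<^sup>2\<close> (\<open>nn_integral_DA_weight_mi_power\<close>); the square of the
  binomial coefficient cancels \<open>((m + n)!)\<^sup>2\<close> and leaves \<open>\<alpha>! / m!\<close>, up to the constant
  \<open>\<pi>\<^sup>n\<^sup>+\<^sup>1 / (n n!)\<close>.

  The moments are found without polar coordinates. If \<open>h\<close> is homogeneous, scaling determines the
  image of \<open>h d\<zeta>\<close> under \<open>\<zeta> \<mapsto> |\<zeta>|\<^sup>2\<close> up to one constant, which is the integral of \<open>h\<close> over
  the unit ball (\<open>nn_integral_homogeneous_radial\<close>). For \<open>h = |\<zeta>\<^sup>\<alpha>|\<^sup>2\<close> the constant can be
  read off from the integral of \<open>h\<close> against a Gaussian, which factorises over the coordinates.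
  A Beta integral then gives the weighted moment.

  The power series need not converge uniformly up to the boundary, so orthogonality cannot be
  applied to the whole series at once. The sets
  \<open>{\<zeta>. \<Sum> |c\<^sub>\<alpha> \<zeta>\<^sup>\<alpha>| \<le> B}\<close> are again invariant under rotation of coordinates and exhaust the
  ball; on each of them dominated convergence applies to the partial sums, and monotone
  convergence lets \<open>B\<close> tend to infinity. The same Parseval identity, applied to the zero function,
  shows that the coefficients of a power series are unique.
\<close>

(* The dollar sign is reserved for components of vectors. *)
unbundle no fps_syntax

section \<open>Lebesgue measure on complex vectors\<close>

lemma borel_measurable_vec_lambda:
  fixes h :: "'x \<Rightarrow> 'm::finite \<Rightarrow> 'b::euclidean_space"
  assumes "\<And>i. (\<lambda>x. h x i) \<in> borel_measurable M"
  shows "(\<lambda>x. \<chi> i. h x i) \<in> borel_measurable M"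
proof (subst borel_measurable_euclidean_space, safe)
  fix b :: "'b ^ 'm"
  assume "b \<in> Basis"
  then obtain j u where b: "b = axis j u" "u \<in> Basis"
    by (auto simp: Basis_vec_def)
  show "(\<lambda>x. (\<chi> i. h x i) \<bullet> b) \<in> borel_measurable M"
    using assms[of j] by (simp add: b inner_axis)
qed

lemma borel_measurable_vec_nth [measurable]:
  "(\<lambda>x::'b::euclidean_space ^ 'm::finite. x $ i) \<in> borel_measurable borel"
  by (intro borel_measurable_continuous_onI continuous_intros)

interpretation lborel_power: product_sigma_finite "\<lambda>i::'m. lborel :: 'b::euclidean_space measure"
  by standard

lemma box_vec_iff:
  fixes l u x :: "'b::euclidean_space ^ 'm::finite"
  shows "x \<in> box l u \<longleftrightarrow> (\<forall>i. x $ i \<in> box (l $ i) (u $ i))"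
  by (auto simp: mem_box Basis_vec_def inner_axis)

lemma prod_Basis_vec:
  fixes h :: "'b::euclidean_space ^ 'm::finite \<Rightarrow> 'c::comm_monoid_mult"
  shows "(\<Prod>b\<in>Basis. h b) = (\<Prod>i\<in>UNIV. \<Prod>u\<in>Basis. h (axis i u))"
proof -
  let ?a = "\<lambda>(i,u). axis i u :: 'b ^ 'm"
  have img: "Basis = ?a ` (UNIV \<times> Basis)"
    by (auto simp: Basis_vec_def image_iff)
  have inj: "inj_on ?a (UNIV \<times> Basis)"
    by (auto simp: inj_on_def axis_eq_axis)
  show ?thesis
    unfolding img prod.reindex[OF inj] by (simp add: prod.cartesian_product case_prod_unfold)
qed

text \<open>
  A box in the vector space is a product of boxes, one for each coordinate, so both measures
  agree on boxes. This makes Fubini arguments available one complex coordinate at a time.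
\<close>

lemma lborel_vec_eq_distr_PiM:
  "(lborel :: ('b::euclidean_space ^ 'm::finite) measure)
     = distr (PiM UNIV (\<lambda>_. lborel)) borel (\<lambda>f. \<chi> i. f i)"
proof (rule lborel_eqI)
  have m [measurable]: "(\<lambda>f. \<chi> i. f i :: 'b ^ 'm) \<in> borel_measurable (PiM UNIV (\<lambda>_. lborel))"
    by (intro borel_measurable_vec_lambda) simp
  fix l u :: "'b ^ 'm"
  assume le: "\<And>b. b \<in> Basis \<Longrightarrow> l \<bullet> b \<le> u \<bullet> b"
  have le': "l $ i \<bullet> b \<le> u $ i \<bullet> b" if "b \<in> Basis" for i b
    using le[of "axis i b"] that by (simp add: inner_axis axis_in_Basis_iff)
  have "emeasure (distr (PiM UNIV (\<lambda>_. lborel)) borel (\<lambda>f. \<chi> i. f i)) (box l u)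
        = emeasure (PiM UNIV (\<lambda>_. lborel)) (\<Pi>\<^sub>E i\<in>UNIV. box (l $ i) (u $ i))"
    by (subst emeasure_distr)
       (auto simp: box_vec_iff space_PiM PiE_def Pi_iff intro!: arg_cong2[where f = emeasure])
  also have "\<dots> = (\<Prod>i\<in>UNIV. ennreal (\<Prod>b\<in>Basis. (u $ i - l $ i) \<bullet> b))"
    using le' by (subst lborel_power.emeasure_PiM) (auto simp: emeasure_lborel_box_eq)
  also have "\<dots> = ennreal (\<Prod>i\<in>UNIV. \<Prod>b\<in>Basis. (u $ i - l $ i) \<bullet> b)"
    using le' by (intro prod_ennreal) (auto intro!: prod_nonneg simp: inner_diff_left)
  also have "\<dots> = ennreal (\<Prod>b\<in>Basis. (u - l) \<bullet> b)"
    by (simp add: prod_Basis_vec inner_axis)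
  finally show "emeasure (distr (PiM UNIV (\<lambda>_. lborel)) borel (\<lambda>f. \<chi> i. f i)) (box l u)
      = ennreal (\<Prod>b\<in>Basis. (u - l) \<bullet> b)" .
qed simp

lemma nn_integral_lborel_vec_prod:
  fixes h :: "'m::finite \<Rightarrow> 'b::euclidean_space \<Rightarrow> ennreal"
  assumes [measurable]: "\<And>i. h i \<in> borel_measurable borel"
  shows "(\<integral>\<^sup>+x. (\<Prod>i\<in>UNIV. h i (x $ i)) \<partial>(lborel :: ('b ^ 'm) measure))
     = (\<Prod>i\<in>UNIV. \<integral>\<^sup>+z. h i z \<partial>lborel)"
proof -
  have [measurable]: "(\<lambda>f. \<chi> i. f i :: 'b ^ 'm) \<in> borel_measurable (PiM UNIV (\<lambda>_. lborel))"
    by (intro borel_measurable_vec_lambda) simp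
  show ?thesis
    by (subst lborel_vec_eq_distr_PiM, subst nn_integral_distr)
       (simp_all add: lborel_power.product_nn_integral_prod)
qed

lemma emeasure_lborel_vec_Times:
  assumes [measurable]: "\<And>i. S i \<in> sets borel"
  shows "emeasure lborel {x :: 'b::euclidean_space ^ 'm::finite. \<forall>i. x $ i \<in> S i}
           = (\<Prod>i\<in>UNIV. emeasure lborel (S i))"
proof -
  have "emeasure lborel {x :: 'b ^ 'm. \<forall>i. x $ i \<in> S i}
         = (\<integral>\<^sup>+x. indicator {x :: 'b ^ 'm. \<forall>i. x $ i \<in> S i} x \<partial>lborel)"
    by (rule nn_integral_indicator[symmetric]) measurable
  also have "\<dots> = (\<integral>\<^sup>+x. (\<Prod>i\<in>UNIV. indicator (S i) (x $ i)) \<partial>(lborel :: ('b ^ 'm) measure))"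
    by (intro nn_integral_cong) (auto simp: indicator_def prod_zero_iff)
  also have "\<dots> = (\<Prod>i\<in>UNIV. \<integral>\<^sup>+z. indicator (S i) z \<partial>lborel)"
    by (rule nn_integral_lborel_vec_prod) simp
  finally show ?thesis
    by simp
qed

lemma lborel_complex_eq_distr_pair:
  "(lborel :: complex measure) = distr (lborel \<Otimes>\<^sub>M lborel) borel (\<lambda>(x, y). Complex x y)"
proof (rule lborel_eqI)
  have [measurable]: "(\<lambda>(x, y). Complex x y) \<in> borel_measurable (borel \<Otimes>\<^sub>M borel)"
    unfolding Complex_eq case_prod_unfold by measurable
  fix l u :: complex
  assume le: "\<And>b. b \<in> Basis \<Longrightarrow> l \<bullet> b \<le> u \<bullet> b"
  have le': "Re l \<le> Re u" "Im l \<le> Im u"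
    using le[of 1] le[of \<i>] by (auto simp: Basis_complex_def)
  have "emeasure (distr (lborel \<Otimes>\<^sub>M lborel) borel (\<lambda>(x, y). Complex x y)) (box l u)
     = emeasure (lborel \<Otimes>\<^sub>M lborel) ({Re l<..<Re u} \<times> {Im l<..<Im u})"
    by (subst emeasure_distr)
       (auto simp: mem_box Basis_complex_def space_pair_measure intro!: arg_cong2[where f = emeasure])
  also have "\<dots> = ennreal (\<Prod>b\<in>Basis. (u - l) \<bullet> b)"
    using le' by (subst lborel.emeasure_pair_measure_Times)
      (auto simp: Basis_complex_def ennreal_mult' emeasure_lborel_Ioo)
  finally show "emeasure (distr (lborel \<Otimes>\<^sub>M lborel) borel (\<lambda>(x, y). Complex x y)) (box l u) =
       ennreal (\<Prod>b\<in>Basis. (u - l) \<bullet> b)" .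
qed simp

lemma nn_integral_lborel_complex:
  assumes [measurable]: "h \<in> borel_measurable borel"
  shows "(\<integral>\<^sup>+z. h z \<partial>lborel) = (\<integral>\<^sup>+x. \<integral>\<^sup>+y. h (Complex x y) \<partial>lborel \<partial>lborel)"
    and "(\<integral>\<^sup>+z. h z \<partial>lborel) = (\<integral>\<^sup>+y. \<integral>\<^sup>+x. h (Complex x y) \<partial>lborel \<partial>lborel)"
proof -
  have [measurable]: "(\<lambda>(x, y). Complex x y) \<in> borel_measurable (borel \<Otimes>\<^sub>M borel)"
    unfolding Complex_eq case_prod_unfold by measurable
  have eq: "(\<integral>\<^sup>+z. h z \<partial>lborel) = (\<integral>\<^sup>+(x, y). h (Complex x y) \<partial>(lborel \<Otimes>\<^sub>M lborel))"
    by (subst lborel_complex_eq_distr_pair, subst nn_integral_distr)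
       (simp_all add: case_prod_unfold)
  have [measurable]: "(\<lambda>(x, y). h (Complex x y)) \<in> borel_measurable (lborel \<Otimes>\<^sub>M lborel)"
    by (simp add: case_prod_unfold)
  show "(\<integral>\<^sup>+z. h z \<partial>lborel) = (\<integral>\<^sup>+x. \<integral>\<^sup>+y. h (Complex x y) \<partial>lborel \<partial>lborel)"
    unfolding eq by (subst lborel.nn_integral_fst[symmetric]) simp_all
  show "(\<integral>\<^sup>+z. h z \<partial>lborel) = (\<integral>\<^sup>+y. \<integral>\<^sup>+x. h (Complex x y) \<partial>lborel \<partial>lborel)"
    unfolding eq by (subst lborel_pair.nn_integral_snd[symmetric]) simp_all
qed

text \<open>By Fubini, a shear is a translation of the inner variable for each value of the outer one.\<close>

lemma nn_integral_complex_shear: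
  assumes [measurable]: "h \<in> borel_measurable borel"
  shows "(\<integral>\<^sup>+z. h (Complex (Re z + s * Im z) (Im z)) \<partial>lborel) = (\<integral>\<^sup>+z. h z \<partial>lborel)"
    and "(\<integral>\<^sup>+z. h (Complex (Re z) (Im z + s * Re z)) \<partial>lborel) = (\<integral>\<^sup>+z. h z \<partial>lborel)"
proof -
  have transl: "(\<integral>\<^sup>+x. g (x + c) \<partial>lborel) = (\<integral>\<^sup>+x. g x \<partial>lborel)"
    if [measurable]: "g \<in> borel_measurable borel" for g :: "real \<Rightarrow> ennreal" and c
    using nn_integral_real_affine[of g 1 c] by (simp add: add.commute)
  have [measurable]: "(\<lambda>x. h (Complex (a x) (b x))) \<in> borel_measurable borel"
    if [measurable]: "a \<in> borel_measurable borel" "b \<in> borel_measurable borel"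
    for a b :: "'x::topological_space \<Rightarrow> real"
    unfolding Complex_eq by measurable
  have [measurable]: "Re \<in> borel_measurable borel" "Im \<in> borel_measurable borel"
    by (intro borel_measurable_continuous_onI continuous_intros)+
  show "(\<integral>\<^sup>+z. h (Complex (Re z + s * Im z) (Im z)) \<partial>lborel) = (\<integral>\<^sup>+z. h z \<partial>lborel)"
    by (simp add: nn_integral_lborel_complex(2) transl[of "\<lambda>x. h (Complex x _)"])
  show "(\<integral>\<^sup>+z. h (Complex (Re z) (Im z + s * Re z)) \<partial>lborel) = (\<integral>\<^sup>+z. h z \<partial>lborel)"
    by (simp add: nn_integral_lborel_complex(1) transl[of "\<lambda>x. h (Complex _ x)"])
qed

text \<open>
  A rotation by the angle \<open>t\<close> is a product of three shears with parameters \<open>- tan (t/2)\<close>,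
  \<open>sin t\<close>, \<open>- tan (t/2)\<close>. The tangent is the reason for the hypothesis \<open>cos (t/2) \<noteq> 0\<close>.
\<close>

lemma nn_integral_complex_rotation:
  assumes [measurable]: "h \<in> borel_measurable borel" and "cos (t / 2) \<noteq> 0"
  shows "(\<integral>\<^sup>+z. h (cis t * z) \<partial>lborel) = (\<integral>\<^sup>+z. h z \<partial>lborel)"
proof -
  define X where "X s z = Complex (Re z + s * Im z) (Im z)" for s z
  define Y where "Y s z = Complex (Re z) (Im z + s * Re z)" for s z
  have [measurable]: "X s \<in> borel_measurable borel" "Y s \<in> borel_measurable borel" for s
    unfolding X_def Y_def
    by (intro borel_measurable_continuous_onI continuous_intros)+
  define \<tau> where "\<tau> = - tan (t / 2)"
  have st: "sin t = 2 * sin (t/2) * cos (t/2)" "cos t = 1 - 2 * sin (t/2) ^ 2"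
    using sin_double[of "t/2"] cos_double_sin[of "t/2"] by simp_all
  have c: "1 + \<tau> * sin t = cos t"
    using assms(2) by (simp add: st \<tau>_def tan_def power2_eq_square)
  have d: "\<tau> + \<tau> * cos t = - sin t"
  proof -
    have "\<tau> + \<tau> * cos t = - tan (t/2) * (2 * (1 - sin (t/2) ^ 2))"
      by (simp add: \<tau>_def st algebra_simps)
    also have "1 - sin (t/2) ^ 2 = cos (t/2) ^ 2"
      by (simp add: cos_squared_eq)
    finally show ?thesis
      using assms(2) by (simp add: st(1) tan_def power2_eq_square)
  qed
  have rot: "cis t * z = X \<tau> (Y (sin t) (X \<tau> z))" for z
  proof (rule complex_eqI)
    have "Re (X \<tau> (Y (sin t) (X \<tau> z))) = (1 + \<tau> * sin t) * Re z + (\<tau> + \<tau> * (1 + \<tau> * sin t)) * Im z"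
      by (simp add: X_def Y_def algebra_simps)
    thus "Re (cis t * z) = Re (X \<tau> (Y (sin t) (X \<tau> z)))"
      by (simp add: c d)
    have "Im (X \<tau> (Y (sin t) (X \<tau> z))) = (1 + \<tau> * sin t) * Im z + sin t * Re z"
      by (simp add: X_def Y_def algebra_simps)
    thus "Im (cis t * z) = Im (X \<tau> (Y (sin t) (X \<tau> z)))"
      by (simp add: c)
  qed
  have sh: "(\<integral>\<^sup>+z. g (X s z) \<partial>lborel) = (\<integral>\<^sup>+z. g z \<partial>lborel)"
           "(\<integral>\<^sup>+z. g (Y s z) \<partial>lborel) = (\<integral>\<^sup>+z. g z \<partial>lborel)"
    if "g \<in> borel_measurable borel" for g :: "complex \<Rightarrow> ennreal" and s
    using nn_integral_complex_shear[OF that] by (auto simp: X_def Y_def)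
  show ?thesis
    unfolding rot
    using sh(1)[of "\<lambda>z. h (X \<tau> (Y (sin t) z))" \<tau>] sh(2)[of "\<lambda>z. h (X \<tau> z)" "sin t"] sh(1)[of h \<tau>]
    by simp
qed

section \<open>Moments of monomials\<close>

lemma nn_integral_lborel_scale:
  fixes g :: "'a::euclidean_space \<Rightarrow> ennreal"
  assumes [measurable]: "g \<in> borel_measurable borel" and "c > 0"
  shows "(\<integral>\<^sup>+x. g x \<partial>lborel) = ennreal (c ^ DIM('a)) * (\<integral>\<^sup>+x. g (c *\<^sub>R x) \<partial>lborel)"
  using assms(2)
  by (subst lborel_affine[of c 0])
     (simp_all add: nn_integral_density nn_integral_distr nn_integral_cmult)

text \<open>
  A substitute for polar coordinates. By homogeneity the integral of \<open>h\<close> over the ball of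
  radius \<open>c\<close> is \<open>c\<^sup>2\<^sup>p V\<close>, so the image of \<open>h dx\<close> under \<open>x \<mapsto> |x|\<^sup>2\<close> has distribution
  function \<open>V t\<^sup>p\<close> and hence density \<open>V p t\<^sup>p\<^sup>-\<^sup>1\<close> on the half-line.
\<close>

lemma nn_integral_homogeneous_radial:
  fixes h :: "'a::euclidean_space \<Rightarrow> ennreal" and F :: "real \<Rightarrow> ennreal"
  assumes [measurable]: "h \<in> borel_measurable borel" "F \<in> borel_measurable borel"
    and hom: "\<And>c x. c > 0 \<Longrightarrow> h (c *\<^sub>R x) = ennreal (c ^ (2 * m)) * h x"
    and p: "DIM('a) + 2 * m = 2 * p"
    and V: "(\<integral>\<^sup>+x. h x * indicator (cball 0 1) x \<partial>lborel) = ennreal V" "V \<ge> 0"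
  shows "(\<integral>\<^sup>+x. F ((norm x)\<^sup>2) * h x \<partial>lborel)
       = (\<integral>\<^sup>+t. F t * (ennreal (V * real p * t ^ (p - 1)) * indicator {0..} t) \<partial>lborel)"
proof -
  have "p > 0"
    using p DIM_positive[where 'a = 'a] by linarith
  define M where "M = distr (density lborel h) borel (\<lambda>x. (norm x)\<^sup>2)"
  define N where "N = density lborel (\<lambda>t. ennreal (V * real p * t ^ (p - 1)) * indicator {0..} t)"
  have M_atMost: "emeasure M {..a} = (if a < 0 then 0 else ennreal (V * a ^ p))" for a
  proof -
    have eM: "emeasure M {..a} = (\<integral>\<^sup>+x. h x * indicator {x. (norm x)\<^sup>2 \<le> a} x \<partial>lborel)"
      unfolding M_def by (subst emeasure_distr) (auto simp: emeasure_density vimage_def)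
    consider "a < 0" | "a = 0" | "a > 0" by linarith
    thus ?thesis
    proof cases
      case 1
      hence "{x::'a. (norm x)\<^sup>2 \<le> a} = {}"
        by (auto simp: not_le intro: less_le_trans)
      thus ?thesis using 1 by (simp add: eM)
    next
      case 2
      hence "(\<integral>\<^sup>+x. h x * indicator {x. (norm x)\<^sup>2 \<le> a} x \<partial>lborel) = (\<integral>\<^sup>+x. 0 \<partial>(lborel :: 'a measure))"
        by (intro nn_integral_cong_AE eventually_mono[OF AE_lborel_singleton[of 0]]) auto
      thus ?thesis unfolding eM using 2 \<open>p > 0\<close> by (simp add: power_0_left)
    next
      case 3
      define c where "c = sqrt a"
      have c: "c > 0" "a = c\<^sup>2" using 3 by (auto simp: c_def)
      have ind: "indicator {x::'a. (norm x)\<^sup>2 \<le> a} (c *\<^sub>R x) = (indicator (cball 0 1) x :: ennreal)" for x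
        using c by (auto simp: indicator_def power_mult_distrib power2_le_iff_abs_le abs_square_le_1)
      have [measurable]: "cball 0 1 \<in> sets (borel :: 'a measure)"
        by simp
      have "emeasure M {..a}
              = ennreal (c ^ DIM('a)) * (\<integral>\<^sup>+x. ennreal (c ^ (2 * m)) * (h x * indicator (cball 0 1) x) \<partial>lborel)"
        unfolding eM using c(1)
        by (subst nn_integral_lborel_scale[of _ c]) (auto simp: hom ind mult.assoc)
      also have "\<dots> = ennreal (c ^ (DIM('a) + 2 * m) * V)"
        using c(1) V by (simp add: nn_integral_cmult power_add ennreal_mult' mult.assoc)
      also have "c ^ (DIM('a) + 2 * m) = a ^ p"
        unfolding p by (simp add: c(2) power_mult)
      finally show ?thesis using 3 by (simp add: mult.commute)
    qed
  qed
  have N_atMost: "emeasure N {..a} = (if a < 0 then 0 else ennreal (V * a ^ p))" for a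
  proof -
    have eN: "emeasure N {..a} = (\<integral>\<^sup>+t. ennreal (V * real p * t ^ (p - 1)) * indicator {0..a} t \<partial>lborel)"
      unfolding N_def by (subst emeasure_density) (auto simp: indicator_def intro!: nn_integral_cong)
    show ?thesis
    proof (cases "a < 0")
      case False
      have "(\<integral>\<^sup>+t. ennreal (V * real p * t ^ (p - 1)) * indicator {0..a} t \<partial>lborel)
              = V * a ^ p - V * 0 ^ p"
        using False V(2)
        by (intro nn_integral_FTC_Icc) (auto intro!: derivative_eq_intros)
      thus ?thesis using False \<open>p > 0\<close> by (simp add: eN power_0_left)
    qed (simp add: eN)
  qed
  have "M = N"
  proof (rule measure_eqI_generator_eq[where E = "range atMost" and A = "\<lambda>i. {..real i}"])
    show "Int_stable (range (atMost :: real \<Rightarrow> _))"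
      by (auto simp: Int_stable_def)
    show "sets M = sigma_sets UNIV (range atMost)" "sets N = sigma_sets UNIV (range atMost)"
      by (simp_all add: M_def N_def borel_eq_atMost)
    show "(\<Union>i. {..real i}) = UNIV"
      by (auto simp: real_arch_simple)
  qed (auto simp: M_atMost N_atMost)
  have "(\<integral>\<^sup>+x. F ((norm x)\<^sup>2) * h x \<partial>lborel) = (\<integral>\<^sup>+t. F t \<partial>M)"
    unfolding M_def by (simp add: nn_integral_distr nn_integral_density mult.commute)
  also have "\<dots> = (\<integral>\<^sup>+t. F t * (ennreal (V * real p * t ^ (p - 1)) * indicator {0..} t) \<partial>lborel)"
    unfolding \<open>M = N\<close> N_def by (simp add: nn_integral_density mult.commute)
  finally show ?thesis .
qed

lemma nn_integral_power_times_exp: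
  "(\<integral>\<^sup>+t. ennreal (t ^ k * exp (- t)) * indicator {0..} t \<partial>lborel) = ennreal (fact k)"
proof -
  have "(\<integral>\<^sup>+t. ennreal (t ^ k * exp (- t)) * indicator {0..} t \<partial>lborel)
      = (\<integral>\<^sup>+t. ennreal (indicator {0..} t * t powr (real (Suc k) - 1) / exp t) \<partial>lborel)"
    by (intro nn_integral_cong_AE eventually_mono[OF AE_lborel_singleton[of 0]])
       (auto simp: indicator_def powr_realpow exp_minus field_simps)
  also have "\<dots> = ennreal (Gamma (real (Suc k)))"
    by (rule Gamma_conv_nn_integral_real[symmetric]) simp
  finally show ?thesis
    using Gamma_fact[of k, where 'a = real] by (simp add: add.commute)
qed

lemma nn_integral_Beta_nat:
  "(\<integral>\<^sup>+t. ennreal (t ^ m * (1 - t) ^ k) * indicator {0..1} t \<partial>lborel)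
     = ennreal (fact m * fact k / fact (m + k + 1))"
proof -
  have "(\<integral>\<^sup>+t. ennreal (t ^ m * (1 - t) ^ k) * indicator {0..1} t \<partial>lborel)
      = (\<integral>\<^sup>+t. ennreal (indicator {0..1} t *
            (t powr (real (Suc m) - 1) * (1 - t) powr (real (Suc k) - 1))) \<partial>lborel)"
    by (intro nn_integral_cong_AE eventually_mono[OF eventually_conj[OF
            AE_lborel_singleton[of 0] AE_lborel_singleton[of 1]]])
       (auto simp: indicator_def powr_realpow)
  also have "\<dots> = ennreal (Beta (real (Suc m)) (real (Suc k)))"
    by (rule nn_integral_has_integral_lebesgue) (use has_integral_Beta_real[of "real (Suc m)" "real (Suc k)"] in auto)
  also have "Beta (real (Suc m)) (real (Suc k)) = fact m * fact k / fact (m + k + 1)"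
    using Gamma_fact[of m, where 'a = real] Gamma_fact[of k, where 'a = real]
      Gamma_fact[of "m + k + 1", where 'a = real]
    by (simp add: Beta_def add_ac)
  finally show ?thesis .
qed

text \<open>
  The radial formula for \<open>h = 1\<close> in the plane, where the constant is the area \<open>\<pi>\<close> of the disc.
\<close>

lemma nn_integral_complex_gaussian_moment:
  "(\<integral>\<^sup>+z. ennreal (cmod z ^ (2 * k) * exp (- (cmod z)\<^sup>2)) \<partial>lborel) = ennreal (pi * fact k)"
proof -
  have "(\<integral>\<^sup>+z. ennreal (((cmod z)\<^sup>2) ^ k * exp (- (cmod z)\<^sup>2)) * 1 \<partial>lborel)
     = (\<integral>\<^sup>+t. ennreal (t ^ k * exp (- t)) * (ennreal (pi * real 1 * t ^ (1 - 1)) * indicator {0..} t) \<partial>lborel)"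
  proof (rule nn_integral_homogeneous_radial[where m = 0])
    show "(\<integral>\<^sup>+x. 1 * indicator (cball 0 1) x \<partial>(lborel :: complex measure)) = ennreal pi"
      using emeasure_cball[of 1 "0 :: complex"] by (simp add: unit_ball_vol_2)
  qed auto
  also have "\<dots> = ennreal pi * (\<integral>\<^sup>+t. ennreal (t ^ k * exp (- t)) * indicator {0..} t \<partial>lborel)"
    by (subst nn_integral_cmult[symmetric]) (auto intro!: nn_integral_cong simp: mult_ac)
  finally show ?thesis
    by (simp add: nn_integral_power_times_exp ennreal_mult' power_mult)
qed

lemma norm_vec_power2: "(norm (\<zeta> :: complex ^ 'm::finite))\<^sup>2 = (\<Sum>i\<in>UNIV. (cmod (\<zeta> $ i))\<^sup>2)"
  by (simp add: norm_vec_def L2_set_def real_sqrt_pow2 sum_nonneg)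

lemma measurable_mi_power [measurable]: "(\<lambda>\<zeta>. mi_power \<zeta> \<alpha>) \<in> borel_measurable borel"
  unfolding mi_power_def by measurable

lemma cmod_mi_power: "cmod (mi_power \<zeta> \<alpha>) = (\<Prod>i\<in>UNIV. cmod (\<zeta> $ i) ^ \<alpha> i)"
  by (simp add: mi_power_def prod_norm[symmetric] norm_power)

lemma mi_power_scaleR: "mi_power (c *\<^sub>R \<zeta>) \<alpha> = of_real c ^ mi_deg \<alpha> * mi_power \<zeta> \<alpha>"
proof -
  have "(c *\<^sub>R \<zeta>) $ i = of_real c * \<zeta> $ i" for i
    by (subst vector_scaleR_component) (simp add: scaleR_conv_of_real)
  thus ?thesis
    by (simp only: mi_power_def mi_deg_def power_mult_distrib prod.distrib power_sum)
qed

lemma cmod_mi_power_le_1: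
  assumes "norm \<zeta> \<le> 1"
  shows "cmod (mi_power \<zeta> \<alpha>) \<le> 1"
  unfolding cmod_mi_power
  by (intro prod_le_1 conjI power_le_one zero_le_power norm_ge_zero)
     (use Finite_Cartesian_Product.norm_nth_le[of \<zeta>] assms in \<open>auto intro: order_trans\<close>)

lemma nn_integral_gaussian_mi_power:
  "(\<integral>\<^sup>+\<zeta>. ennreal (exp (- (norm \<zeta>)\<^sup>2)) * ennreal ((cmod (mi_power \<zeta> \<alpha>))\<^sup>2)
        \<partial>(lborel :: (complex ^ 'm::finite) measure)) = ennreal (pi ^ CARD('m) * mi_fact \<alpha>)"
proof -
  have "ennreal (exp (- (norm \<zeta>)\<^sup>2)) * ennreal ((cmod (mi_power \<zeta> \<alpha>))\<^sup>2)
      = (\<Prod>i\<in>UNIV. ennreal (cmod (\<zeta> $ i) ^ (2 * \<alpha> i) * exp (- (cmod (\<zeta> $ i))\<^sup>2)))" for \<zeta> :: "complex ^ 'm"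
  proof -
    have "exp (- (norm \<zeta>)\<^sup>2) = (\<Prod>i\<in>UNIV. exp (- (cmod (\<zeta> $ i))\<^sup>2))"
      by (simp add: norm_vec_power2 exp_sum flip: sum_negf)
    moreover have "(cmod (mi_power \<zeta> \<alpha>))\<^sup>2 = (\<Prod>i\<in>UNIV. cmod (\<zeta> $ i) ^ (2 * \<alpha> i))"
      by (simp add: cmod_mi_power mult.commute power_mult flip: prod_power_distrib)
    ultimately have "exp (- (norm \<zeta>)\<^sup>2) * (cmod (mi_power \<zeta> \<alpha>))\<^sup>2
        = (\<Prod>i\<in>UNIV. cmod (\<zeta> $ i) ^ (2 * \<alpha> i) * exp (- (cmod (\<zeta> $ i))\<^sup>2))"
      by (simp add: prod.distrib mult.commute)
    thus ?thesis
      by (simp add: prod_ennreal flip: ennreal_mult')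
  qed
  hence "(\<integral>\<^sup>+\<zeta>. ennreal (exp (- (norm \<zeta>)\<^sup>2)) * ennreal ((cmod (mi_power \<zeta> \<alpha>))\<^sup>2)
        \<partial>(lborel :: (complex ^ 'm::finite) measure)) = (\<Prod>i\<in>UNIV. ennreal (pi * fact (\<alpha> i)))"
    by (simp add: nn_integral_lborel_vec_prod[of "\<lambda>i z. ennreal (cmod z ^ (2 * \<alpha> i) * exp (- (cmod z)\<^sup>2))"]
        nn_integral_complex_gaussian_moment)
  also have "\<dots> = ennreal (pi ^ CARD('m) * mi_fact \<alpha>)"
    by (subst prod_ennreal) (simp_all add: prod.distrib mi_fact_def)
  finally show ?thesis .
qed

text \<open>
  The constant of the radial formula for \<open>|\<zeta>\<^sup>\<alpha>|\<^sup>2\<close> is determined by testing that formula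
  with the Gaussian, whose integral is known from \<open>nn_integral_gaussian_mi_power\<close>.
\<close>

lemma nn_integral_radial_mi_power:
  fixes \<alpha> :: "'m::finite multi_index"
  assumes F [measurable]: "F \<in> borel_measurable borel"
  defines "p \<equiv> CARD('m) + mi_deg \<alpha>"
  shows "(\<integral>\<^sup>+\<zeta>. F ((norm \<zeta>)\<^sup>2) * ennreal ((cmod (mi_power \<zeta> \<alpha>))\<^sup>2) \<partial>lborel)
     = (\<integral>\<^sup>+t. F t * (ennreal (pi ^ CARD('m) * mi_fact \<alpha> / fact (p - 1) * t ^ (p - 1)) * indicator {0..} t) \<partial>lborel)"
proof -
  define h where "h \<zeta> = ennreal ((cmod (mi_power \<zeta> \<alpha>))\<^sup>2)" for \<zeta> :: "complex ^ 'm"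
  have [measurable]: "h \<in> borel_measurable borel"
    unfolding h_def by measurable
  have hom: "h (c *\<^sub>R \<zeta>) = ennreal (c ^ (2 * mi_deg \<alpha>)) * h \<zeta>" if "c > 0" for c \<zeta>
    using that by (simp add: h_def mi_power_scaleR norm_mult norm_power power_mult_distrib
        ennreal_mult' power_mult[symmetric] mult.commute)
  have dim: "DIM(complex ^ 'm) + 2 * mi_deg \<alpha> = 2 * p"
    by (simp add: p_def)
  have "p > 0"
    by (simp add: p_def)
  have "(\<integral>\<^sup>+\<zeta>. h \<zeta> * indicator (cball 0 1) \<zeta> \<partial>lborel) \<le> (\<integral>\<^sup>+\<zeta>. indicator (cball 0 1) \<zeta> \<partial>(lborel :: (complex ^ 'm) measure))"
    by (intro nn_integral_mono) (auto simp: h_def indicator_def cmod_mi_power_le_1 abs_square_le_1)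
  also have "\<dots> < \<infinity>"
    using emeasure_compact_finite[of "cball 0 1 :: (complex ^ 'm) set"] by simp
  finally obtain V where V: "(\<integral>\<^sup>+\<zeta>. h \<zeta> * indicator (cball 0 1) \<zeta> \<partial>lborel) = ennreal V" "V \<ge> 0"
    by (metis enn2real_nonneg ennreal_enn2real infinity_ennreal_def)
  note rad = nn_integral_homogeneous_radial[OF _ _ hom dim V]
  (* Both sides are the Gaussian integral; comparing them yields V. *)
  have "ennreal (pi ^ CARD('m) * mi_fact \<alpha>)
     = (\<integral>\<^sup>+t. ennreal (exp (- t)) * (ennreal (V * real p * t ^ (p - 1)) * indicator {0..} t) \<partial>lborel)"
    using rad[of "\<lambda>t. ennreal (exp (- t))"] nn_integral_gaussian_mi_power[of \<alpha>] by (simp add: h_def)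
  also have "\<dots> = (\<integral>\<^sup>+t. ennreal (V * real p) * (ennreal (t ^ (p - 1) * exp (- t)) * indicator {0..} t) \<partial>lborel)"
    using V by (intro nn_integral_cong) (auto simp: indicator_def ennreal_mult'[symmetric] mult_ac)
  also have "\<dots> = ennreal (V * real p) * ennreal (fact (p - 1))"
    by (subst nn_integral_cmult) (simp_all add: nn_integral_power_times_exp)
  also have "\<dots> = ennreal (V * real p * fact (p - 1))"
    using V by (simp add: ennreal_mult')
  finally have "pi ^ CARD('m) * mi_fact \<alpha> = V * real p * fact (p - 1)"
    using V by (subst (asm) ennreal_inj) (auto simp: mi_fact_def prod_nonneg)
  hence "V * real p = pi ^ CARD('m) * mi_fact \<alpha> / fact (p - 1)"
    by simp
  thus ?thesis
    using rad[of F] by (simp add: h_def)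
qed

lemma nn_integral_ball_mi_power:
  fixes \<alpha> :: "'m::finite multi_index"
  shows "(\<integral>\<^sup>+\<zeta>. ennreal (indicator (ball 0 1) \<zeta>) * ennreal ((cmod (mi_power \<zeta> \<alpha>))\<^sup>2) \<partial>lborel)
     = ennreal (pi ^ CARD('m) * mi_fact \<alpha> / fact (CARD('m) + mi_deg \<alpha>))"
proof -
  define p where "p = CARD('m) + mi_deg \<alpha>"
  define C where "C = pi ^ CARD('m) * mi_fact \<alpha> / fact (p - 1)"
  have p: "p > 0"
    by (simp add: p_def)
  have C: "C \<ge> 0"
    by (auto simp: C_def mi_fact_def intro!: divide_nonneg_nonneg mult_nonneg_nonneg prod_nonneg)
  have "(\<integral>\<^sup>+\<zeta>. ennreal (indicator (ball 0 1) \<zeta>) * ennreal ((cmod (mi_power \<zeta> \<alpha>))\<^sup>2) \<partial>lborel)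
     = (\<integral>\<^sup>+\<zeta>. indicator {..<1} ((norm \<zeta>)\<^sup>2) * ennreal ((cmod (mi_power \<zeta> \<alpha>))\<^sup>2) \<partial>lborel)"
    by (intro nn_integral_cong) (auto simp: indicator_def abs_square_less_1)
  also have "\<dots> = (\<integral>\<^sup>+t. indicator {..<1} t * (ennreal (C * t ^ (p - 1)) * indicator {0..} t) \<partial>lborel)"
    unfolding C_def p_def by (rule nn_integral_radial_mi_power) simp
  also have "\<dots> = (\<integral>\<^sup>+t. ennreal (C * t ^ (p - 1)) * indicator {0..1} t \<partial>lborel)"
    by (intro nn_integral_cong_AE eventually_mono[OF AE_lborel_singleton[of 1]])
       (auto simp: indicator_def)
  also have "\<dots> = ennreal (C / real p * 1 ^ p - C / real p * 0 ^ p)"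
    using C p by (intro nn_integral_FTC_Icc) (auto intro!: derivative_eq_intros)
  also have "C / real p * 1 ^ p - C / real p * 0 ^ p = pi ^ CARD('m) * mi_fact \<alpha> / fact p"
    using p by (simp add: C_def power_0_left fact_reduce[of p])
  finally show ?thesis
    by (simp add: p_def)
qed

section \<open>Parseval's identity for power series on the ball\<close>

definition rotate_coord :: "'m \<Rightarrow> real \<Rightarrow> complex ^ 'm \<Rightarrow> complex ^ 'm" where
  "rotate_coord j t \<zeta> = (\<chi> i. (if i = j then cis t else 1) * \<zeta> $ i)"

lemma measurable_rotate_coord [measurable]:
  "rotate_coord j t \<in> borel_measurable (borel :: (complex ^ 'm::finite) measure)"
  unfolding rotate_coord_def[abs_def] by (intro borel_measurable_vec_lambda) measurable

lemma lborel_rotate_coord: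
  assumes "cos (t / 2) \<noteq> 0"
  shows "distr lborel borel (rotate_coord j t) = (lborel :: (complex ^ 'm::finite) measure)"
proof (rule sym, rule lborel_eqI)
  fix l u :: "complex ^ 'm"
  assume le: "\<And>b. b \<in> Basis \<Longrightarrow> l \<bullet> b \<le> u \<bullet> b"
  define c where "c i = (if i = j then cis t else 1)" for i
  define S where "S i = {z. c i * z \<in> box (l $ i) (u $ i)}" for i
  have S: "S i \<in> sets borel" for i
    unfolding S_def by measurable
  have eS: "emeasure lborel (S i) = emeasure lborel (box (l $ i) (u $ i))" for i
  proof -
    have "(\<integral>\<^sup>+z. indicator (box (l $ i) (u $ i)) (c i * z) \<partial>lborel)
            = (\<integral>\<^sup>+z. indicator (box (l $ i) (u $ i)) z \<partial>lborel)"
      using assms nn_integral_complex_rotation[of "indicator (box (l $ i) (u $ i))" t]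
      by (auto simp: c_def)
    moreover have "indicator (box (l $ i) (u $ i)) (c i * z) = (indicator (S i) z :: ennreal)" for z
      by (auto simp: S_def indicator_def)
    ultimately show ?thesis
      using S[of i] by simp
  qed
  have "emeasure (distr lborel borel (rotate_coord j t)) (box l u)
        = emeasure lborel {x :: complex ^ 'm. \<forall>i. x $ i \<in> S i}"
    by (subst emeasure_distr)
       (simp_all add: box_vec_iff rotate_coord_def S_def c_def vimage_def)
  also have "\<dots> = (\<Prod>i\<in>UNIV. emeasure lborel (box (l $ i) (u $ i)))"
    using S by (simp add: emeasure_lborel_vec_Times eS)
  also have "\<dots> = emeasure lborel {x :: complex ^ 'm. \<forall>i. x $ i \<in> box (l $ i) (u $ i)}"
    by (subst emeasure_lborel_vec_Times) simp_all
  also have "{x :: complex ^ 'm. \<forall>i. x $ i \<in> box (l $ i) (u $ i)} = box l u"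
    by (auto simp: box_vec_iff)
  finally show "emeasure (distr lborel borel (rotate_coord j t)) (box l u)
      = ennreal (\<Prod>b\<in>Basis. (u - l) \<bullet> b)"
    using le by (simp add: emeasure_lborel_box_eq)
qed simp

lemma ex_enum_multi_index: "\<exists>e :: nat \<Rightarrow> 'm::finite multi_index. bij e"
proof -
  have "inj (\<lambda>k. (\<lambda>_. k) :: 'm multi_index)"
    by (auto simp: inj_on_def fun_eq_iff)
  hence "infinite (UNIV :: 'm multi_index set)"
    using finite_subset[of "range (\<lambda>k. (\<lambda>_. k) :: 'm multi_index)" UNIV] finite_imageD
      infinite_UNIV_nat by blast
  thus ?thesis
    using bij_betw_from_nat_into[of "UNIV :: 'm multi_index set"] by auto
qed

lemma mi_power_rotate_coord: "mi_power (rotate_coord j t \<zeta>) \<alpha> = cis (real (\<alpha> j) * t) * mi_power \<zeta> \<alpha>"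
proof -
  have "(\<Prod>i\<in>UNIV. (if i = j then cis t else 1) ^ \<alpha> i) = cis t ^ \<alpha> j"
    by (subst prod.remove[of _ j]) (auto intro!: prod.neutral)
  thus ?thesis
    by (simp add: mi_power_def rotate_coord_def power_mult_distrib prod.distrib Complex.DeMoivre)
qed

lemma norm_rotate_coord: "norm (rotate_coord j t \<zeta> :: complex ^ 'm::finite) = norm \<zeta>"
proof -
  have "cmod (rotate_coord j t \<zeta> $ i) = cmod (\<zeta> $ i)" for i
    by (auto simp: rotate_coord_def norm_mult)
  thus ?thesis
    by (simp add: norm_vec_def)
qed

lemma measurable_cnj [measurable]: "cnj \<in> borel_measurable borel"
  by (intro borel_measurable_continuous_onI continuous_intros)

text \<open>
  Pick a coordinate \<open>j\<close> in which the exponents differ, by \<open>d\<close> say. Rotating it by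
  \<open>t = \<pi> / (2 d)\<close> preserves Lebesgue measure and \<open>U\<close> and multiplies the integrand by
  \<open>\<i>\<close>, so the integral is \<open>\<i>\<close> times itself. Since \<open>|t| \<le> \<pi>/2\<close>, the angle is admissible
  for \<open>lborel_rotate_coord\<close>.
\<close>

lemma integral_mi_power_orthogonal:
  fixes U :: "complex ^ 'm::finite \<Rightarrow> real"
  assumes [measurable]: "U \<in> borel_measurable borel"
    and inv: "\<And>j t \<zeta>. U (rotate_coord j t \<zeta>) = U \<zeta>"
    and "\<alpha> \<noteq> \<beta>"
  shows "(LINT \<zeta>|lborel. of_real (U \<zeta>) * (mi_power \<zeta> \<alpha> * cnj (mi_power \<zeta> \<beta>))) = 0"
proof -
  define q where "q \<zeta> = complex_of_real (U \<zeta>) * (mi_power \<zeta> \<alpha> * cnj (mi_power \<zeta> \<beta>))" for \<zeta>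
  have [measurable]: "q \<in> borel_measurable borel"
    unfolding q_def by measurable
  obtain j where j: "\<alpha> j \<noteq> \<beta> j"
    using \<open>\<alpha> \<noteq> \<beta>\<close> by auto
  define d where "d = real (\<alpha> j) - real (\<beta> j)"
  have d: "\<bar>d\<bar> \<ge> 1"
    using j by (auto simp: d_def)
  define t where "t = pi / (2 * d)"
  have "\<bar>t / 2\<bar> = pi / (4 * \<bar>d\<bar>)"
    by (simp add: t_def abs_mult)
  also have "\<dots> \<le> pi / 4"
    using d by (simp add: field_simps)
  finally have "cos (t / 2) > 0"
    using pi_gt_zero by (intro cos_gt_zero_pi) linarith+
  hence "(LINT \<zeta>|lborel. q \<zeta>) = (LINT \<zeta>|lborel. q (rotate_coord j t \<zeta>))"
    using integral_distr[of "rotate_coord j t" lborel borel q] lborel_rotate_coord[of t j] by simp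
  moreover have "q (rotate_coord j t \<zeta>) = \<i> * q \<zeta>" for \<zeta>
  proof -
    have "cis (real (\<alpha> j) * t) * cnj (cis (real (\<beta> j) * t)) = cis (d * t)"
      by (simp add: cis_cnj cis_mult d_def algebra_simps)
    also have "d * t = pi / 2"
      using d by (auto simp: t_def)
    finally have "cis (real (\<alpha> j) * t) * cnj (cis (real (\<beta> j) * t)) = \<i>"
      by simp
    moreover have "q (rotate_coord j t \<zeta>) = cis (real (\<alpha> j) * t) * cnj (cis (real (\<beta> j) * t)) * q \<zeta>"
      by (simp add: q_def inv mi_power_rotate_coord mult_ac)
    ultimately show ?thesis by simp
  qed
  ultimately have "(LINT \<zeta>|lborel. q \<zeta>) = \<i> * (LINT \<zeta>|lborel. q \<zeta>)"
    by simp
  hence "(1 - \<i>) * (LINT \<zeta>|lborel. q \<zeta>) = 0"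
    by (simp add: algebra_simps)
  moreover have "1 - \<i> \<noteq> 0"
    by (simp add: complex_eq_iff)
  ultimately show ?thesis
    by (simp add: q_def)
qed

text \<open>Expand the square into a double sum: only the diagonal terms survive integration.\<close>

lemma nn_integral_mi_power_sum:
  fixes U :: "complex ^ 'm::finite \<Rightarrow> real"
  assumes U: "integrable lborel U" "\<And>\<zeta>. U \<zeta> \<ge> 0"
    and inv: "\<And>j t \<zeta>. U (rotate_coord j t \<zeta>) = U \<zeta>"
    and supp: "\<And>\<zeta>. norm \<zeta> \<ge> 1 \<Longrightarrow> U \<zeta> = 0"
    and "finite A"
  shows "(\<integral>\<^sup>+\<zeta>. ennreal (U \<zeta> * (cmod (\<Sum>\<alpha>\<in>A. c \<alpha> * mi_power \<zeta> \<alpha>))\<^sup>2) \<partial>lborel)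
       = (\<integral>\<^sup>+\<zeta>. ennreal (U \<zeta> * (\<Sum>\<alpha>\<in>A. (cmod (c \<alpha> * mi_power \<zeta> \<alpha>))\<^sup>2)) \<partial>lborel)"
proof -
  have [measurable]: "U \<in> borel_measurable borel"
    using U(1) by auto
  define q where "q \<alpha> \<beta> \<zeta> = complex_of_real (U \<zeta>) * (mi_power \<zeta> \<alpha> * cnj (mi_power \<zeta> \<beta>))" for \<alpha> \<beta> \<zeta>
  have le: "cmod (q \<alpha> \<beta> \<zeta>) \<le> U \<zeta>" for \<alpha> \<beta> \<zeta>
  proof (cases "norm \<zeta> < 1")
    case True
    hence "cmod (mi_power \<zeta> \<alpha>) * cmod (mi_power \<zeta> \<beta>) \<le> 1 * 1"
      by (intro mult_mono cmod_mi_power_le_1) auto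
    thus ?thesis
      using U(2)[of \<zeta>] by (auto simp: q_def norm_mult mult_left_le)
  qed (use supp in \<open>auto simp: q_def\<close>)
  have q: "integrable lborel (q \<alpha> \<beta>)" for \<alpha> \<beta>
  proof (rule Bochner_Integration.integrable_bound[OF U(1)])
    show "q \<alpha> \<beta> \<in> borel_measurable lborel"
      unfolding q_def by measurable
  qed (use le U in auto)
  have orth: "integral\<^sup>L lborel (q \<alpha> \<beta>) = 0" if "\<alpha> \<noteq> \<beta>" for \<alpha> \<beta>
    unfolding q_def by (rule integral_mi_power_orthogonal) (use inv that in auto)
  have ex1: "complex_of_real (U \<zeta> * (cmod (\<Sum>\<alpha>\<in>A. c \<alpha> * mi_power \<zeta> \<alpha>))\<^sup>2)
      = (\<Sum>\<alpha>\<in>A. \<Sum>\<beta>\<in>A. c \<alpha> * cnj (c \<beta>) * q \<alpha> \<beta> \<zeta>)" for \<zeta>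
    by (simp only: of_real_mult complex_norm_square cnj_sum sum_product q_def sum_distrib_left
        complex_cnj_mult mult_ac) (rule sum.swap)
  have ex2: "complex_of_real (U \<zeta> * (\<Sum>\<alpha>\<in>A. (cmod (c \<alpha> * mi_power \<zeta> \<alpha>))\<^sup>2))
      = (\<Sum>\<alpha>\<in>A. c \<alpha> * cnj (c \<alpha>) * q \<alpha> \<alpha> \<zeta>)" for \<zeta>
    by (simp only: of_real_mult of_real_sum complex_norm_square q_def sum_distrib_left
        complex_cnj_mult mult_ac)
  have int1: "integrable lborel (\<lambda>\<zeta>. U \<zeta> * (cmod (\<Sum>\<alpha>\<in>A. c \<alpha> * mi_power \<zeta> \<alpha>))\<^sup>2)"
    and int2: "integrable lborel (\<lambda>\<zeta>. U \<zeta> * (\<Sum>\<alpha>\<in>A. (cmod (c \<alpha> * mi_power \<zeta> \<alpha>))\<^sup>2))"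
    by (subst complex_of_real_integrable_eq [symmetric], unfold ex1 ex2,
        intro Bochner_Integration.integrable_sum integrable_mult_right q)+
  have "complex_of_real (LINT \<zeta>|lborel. U \<zeta> * (cmod (\<Sum>\<alpha>\<in>A. c \<alpha> * mi_power \<zeta> \<alpha>))\<^sup>2)
      = (\<Sum>\<alpha>\<in>A. \<Sum>\<beta>\<in>A. c \<alpha> * cnj (c \<beta>) * integral\<^sup>L lborel (q \<alpha> \<beta>))"
    by (simp only: integral_complex_of_real[symmetric] ex1) (simp add: q)
  also have "\<dots> = (\<Sum>\<alpha>\<in>A. \<Sum>\<beta>\<in>A. if \<alpha> = \<beta> then c \<alpha> * cnj (c \<alpha>) * integral\<^sup>L lborel (q \<alpha> \<alpha>) else 0)"
    using orth by (intro sum.cong refl) auto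
  also have "\<dots> = (\<Sum>\<alpha>\<in>A. c \<alpha> * cnj (c \<alpha>) * integral\<^sup>L lborel (q \<alpha> \<alpha>))"
    using \<open>finite A\<close> by simp
  also have "\<dots> = complex_of_real (LINT \<zeta>|lborel. U \<zeta> * (\<Sum>\<alpha>\<in>A. (cmod (c \<alpha> * mi_power \<zeta> \<alpha>))\<^sup>2))"
    by (simp only: integral_complex_of_real[symmetric] ex2) (simp add: q)
  finally have "(LINT \<zeta>|lborel. U \<zeta> * (cmod (\<Sum>\<alpha>\<in>A. c \<alpha> * mi_power \<zeta> \<alpha>))\<^sup>2)
      = (LINT \<zeta>|lborel. U \<zeta> * (\<Sum>\<alpha>\<in>A. (cmod (c \<alpha> * mi_power \<zeta> \<alpha>))\<^sup>2))"
    unfolding of_real_eq_iff .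
  thus ?thesis
    using int1 int2 U(2) by (simp add: nn_integral_eq_integral sum_nonneg)
qed

lemma has_power_series_sums:
  assumes "has_power_series f a" "norm \<zeta> < 1" "bij e"
  shows "(\<lambda>k. a (e k) * mi_power \<zeta> (e k)) sums f \<zeta>"
    and "summable (\<lambda>k. cmod (a (e k) * mi_power \<zeta> (e k)))"
proof -
  have "((\<lambda>\<alpha>. a \<alpha> * mi_power \<zeta> \<alpha>) has_sum f \<zeta>) UNIV"
    using assms(1,2) by (auto simp: has_power_series_def)
  hence *: "((\<lambda>k. a (e k) * mi_power \<zeta> (e k)) has_sum f \<zeta>) UNIV"
    using has_sum_reindex_bij_betw[OF assms(3), where f = "\<lambda>\<alpha>. a \<alpha> * mi_power \<zeta> \<alpha>"] by simp
  thus "(\<lambda>k. a (e k) * mi_power \<zeta> (e k)) sums f \<zeta>"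
    by (rule has_sum_imp_sums)
  show "summable (\<lambda>k. cmod (a (e k) * mi_power \<zeta> (e k)))"
    using * by (intro summable_on_imp_summable)
      (auto simp: summable_on_iff_abs_summable_on_complex[symmetric] summable_on_def)
qed

text \<open>
  Only the values on the ball are governed by the series, hence the indicator: outside the ball
  \<open>f\<close> may be any function.
\<close>

lemma measurable_power_series:
  fixes f :: "complex ^ 'm::finite \<Rightarrow> complex"
  assumes "has_power_series f a"
  shows "(\<lambda>\<zeta>. indicator (ball 0 1) \<zeta> * f \<zeta>) \<in> borel_measurable borel"
proof -
  obtain e :: "nat \<Rightarrow> 'm multi_index" where e: "bij e"
    using ex_enum_multi_index by blast
  have [measurable]: "ball 0 1 \<in> sets (borel :: (complex ^ 'm) measure)"
    by simp
  show ?thesis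
  proof (rule borel_measurable_LIMSEQ_metric)
    show "(\<lambda>\<zeta>. indicator (ball 0 1) \<zeta> * (\<Sum>k<N. a (e k) * mi_power \<zeta> (e k))) \<in> borel_measurable borel" for N
      by measurable
    show "(\<lambda>N. indicator (ball 0 1) \<zeta> * (\<Sum>k<N. a (e k) * mi_power \<zeta> (e k)))
            \<longlonglongrightarrow> indicator (ball 0 1) \<zeta> * f \<zeta>" for \<zeta>
      using has_power_series_sums(1)[OF assms _ e, of \<zeta>]
      by (auto simp: indicator_def sums_def)
  qed
qed

text \<open>
  Parseval's identity under the extra hypothesis that the weight lives where the absolute series
  is at most \<open>B\<close>. There all partial sums are bounded by \<open>B\<close>, so dominated convergence carries
  the finite identity over to the whole series.
\<close>

lemma nn_integral_power_series_truncated: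
  fixes U :: "complex ^ 'm::finite \<Rightarrow> real" and e :: "nat \<Rightarrow> 'm multi_index"
  assumes U: "integrable lborel U" "\<And>\<zeta>. U \<zeta> \<ge> 0"
    and inv: "\<And>j t \<zeta>. U (rotate_coord j t \<zeta>) = U \<zeta>"
    and supp: "\<And>\<zeta>. norm \<zeta> \<ge> 1 \<Longrightarrow> U \<zeta> = 0"
    and bd: "\<And>\<zeta>. (\<Sum>k. cmod (c (e k) * mi_power \<zeta> (e k))) > B \<Longrightarrow> U \<zeta> = 0"
    and f: "has_power_series f c" and e: "bij e"
  shows "(\<integral>\<^sup>+\<zeta>. ennreal (U \<zeta> * (cmod (f \<zeta>))\<^sup>2) \<partial>lborel)
       = (\<integral>\<^sup>+\<zeta>. ennreal (U \<zeta>) * (\<Sum>k. ennreal ((cmod (c (e k) * mi_power \<zeta> (e k)))\<^sup>2)) \<partial>lborel)"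
proof -
  have [measurable]: "U \<in> borel_measurable borel"
    using U(1) by auto
  define S where "S N \<zeta> = (\<Sum>k<N. c (e k) * mi_power \<zeta> (e k))" for N \<zeta>
  define T where "T k \<zeta> = (cmod (c (e k) * mi_power \<zeta> (e k)))\<^sup>2" for k \<zeta>
  have [measurable]: "S N \<in> borel_measurable borel" "T k \<in> borel_measurable borel" for N k
    unfolding S_def T_def by measurable
  have [measurable]: "(\<lambda>\<zeta>. U \<zeta> * (cmod (f \<zeta>))\<^sup>2) \<in> borel_measurable borel"
  proof -
    have [measurable]: "(\<lambda>\<zeta>. indicator (ball 0 1) \<zeta> * f \<zeta>) \<in> borel_measurable borel"
      by (rule measurable_power_series[OF f])
    have "(\<lambda>\<zeta>. U \<zeta> * (cmod (f \<zeta>))\<^sup>2) = (\<lambda>\<zeta>. U \<zeta> * (cmod (indicator (ball 0 1) \<zeta> * f \<zeta>))\<^sup>2)"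
      using supp by (auto simp: fun_eq_iff indicator_def)
    thus ?thesis by simp
  qed
  have inj: "inj_on e {..<N}" for N
    using e by (auto simp: bij_def intro: inj_on_subset)
  (* Orthogonality for the finite partial sums; both sides then converge as N grows. *)
  have fin: "(\<integral>\<^sup>+\<zeta>. ennreal (U \<zeta> * (cmod (S N \<zeta>))\<^sup>2) \<partial>lborel)
       = (\<Sum>k<N. \<integral>\<^sup>+\<zeta>. ennreal (U \<zeta>) * ennreal (T k \<zeta>) \<partial>lborel)" for N
  proof -
    have "(\<integral>\<^sup>+\<zeta>. ennreal (U \<zeta> * (cmod (S N \<zeta>))\<^sup>2) \<partial>lborel)
            = (\<integral>\<^sup>+\<zeta>. ennreal (U \<zeta> * (\<Sum>k<N. T k \<zeta>)) \<partial>lborel)"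
      using nn_integral_mi_power_sum[OF U inv supp, of "e ` {..<N}" c]
      by (simp add: sum.reindex[OF inj] S_def T_def)
    also have "\<dots> = (\<integral>\<^sup>+\<zeta>. (\<Sum>k<N. ennreal (U \<zeta>) * ennreal (T k \<zeta>)) \<partial>lborel)"
      using U(2) by (intro nn_integral_cong)
        (simp add: T_def ennreal_mult' sum_nonneg flip: sum_distrib_left)
    also have "\<dots> = (\<Sum>k<N. \<integral>\<^sup>+\<zeta>. ennreal (U \<zeta>) * ennreal (T k \<zeta>) \<partial>lborel)"
      by (rule nn_integral_sum) simp
    finally show ?thesis .
  qed
  have "(\<lambda>N. \<integral>\<^sup>+\<zeta>. ennreal (U \<zeta> * (cmod (S N \<zeta>))\<^sup>2) \<partial>lborel)
          \<longlonglongrightarrow> (\<integral>\<^sup>+\<zeta>. ennreal (U \<zeta> * (cmod (f \<zeta>))\<^sup>2) \<partial>lborel)"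
  proof (rule nn_integral_dominated_convergence[where w = "\<lambda>\<zeta>. ennreal (B\<^sup>2 * U \<zeta>)"])
    show "AE \<zeta> in lborel. ennreal (U \<zeta> * (cmod (S N \<zeta>))\<^sup>2) \<le> ennreal (B\<^sup>2 * U \<zeta>)" for N
    proof (intro AE_I2 ennreal_leI)
      fix \<zeta> :: "complex ^ 'm"
      show "U \<zeta> * (cmod (S N \<zeta>))\<^sup>2 \<le> B\<^sup>2 * U \<zeta>"
      proof (cases "U \<zeta> = 0")
        case False
        hence \<zeta>: "norm \<zeta> < 1" "(\<Sum>k. cmod (c (e k) * mi_power \<zeta> (e k))) \<le> B"
          using supp[of \<zeta>] bd[of \<zeta>] by (metis not_le)+
        have "cmod (S N \<zeta>) \<le> (\<Sum>k<N. cmod (c (e k) * mi_power \<zeta> (e k)))"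
          unfolding S_def by (rule norm_sum)
        also have "\<dots> \<le> (\<Sum>k. cmod (c (e k) * mi_power \<zeta> (e k)))"
          using has_power_series_sums(2)[OF f \<zeta>(1) e] by (intro sum_le_suminf) auto
        also have "\<dots> \<le> B" by fact
        finally have "(cmod (S N \<zeta>))\<^sup>2 \<le> B\<^sup>2"
          by (intro power_mono) auto
        thus ?thesis
          using U(2)[of \<zeta>] by (simp add: mult.commute mult_left_mono)
      qed simp
    qed
    have "integrable lborel (\<lambda>\<zeta>. B\<^sup>2 * U \<zeta>)"
      using U(1) by simp
    thus "(\<integral>\<^sup>+\<zeta>. ennreal (B\<^sup>2 * U \<zeta>) \<partial>lborel) < \<infinity>"
      using U(2) by (simp add: nn_integral_eq_integral)
    show "AE \<zeta> in lborel. (\<lambda>N. ennreal (U \<zeta> * (cmod (S N \<zeta>))\<^sup>2)) \<longlonglongrightarrow> ennreal (U \<zeta> * (cmod (f \<zeta>))\<^sup>2)"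
    proof (intro AE_I2)
      fix \<zeta> :: "complex ^ 'm"
      show "(\<lambda>N. ennreal (U \<zeta> * (cmod (S N \<zeta>))\<^sup>2)) \<longlonglongrightarrow> ennreal (U \<zeta> * (cmod (f \<zeta>))\<^sup>2)"
      proof (cases "norm \<zeta> < 1")
        case True
        hence "(\<lambda>N. S N \<zeta>) \<longlonglongrightarrow> f \<zeta>"
          using has_power_series_sums(1)[OF f _ e] by (simp add: S_def sums_def)
        thus ?thesis
          by (intro tendsto_ennrealI tendsto_intros)
      qed (use supp in simp)
    qed
  qed measurable
  moreover have "(\<lambda>N. \<Sum>k<N. \<integral>\<^sup>+\<zeta>. ennreal (U \<zeta>) * ennreal (T k \<zeta>) \<partial>lborel)
          \<longlonglongrightarrow> (\<Sum>k. \<integral>\<^sup>+\<zeta>. ennreal (U \<zeta>) * ennreal (T k \<zeta>) \<partial>lborel)"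
    by (intro summable_LIMSEQ) simp
  ultimately have "(\<integral>\<^sup>+\<zeta>. ennreal (U \<zeta> * (cmod (f \<zeta>))\<^sup>2) \<partial>lborel)
       = (\<Sum>k. \<integral>\<^sup>+\<zeta>. ennreal (U \<zeta>) * ennreal (T k \<zeta>) \<partial>lborel)"
    unfolding fin by (rule LIMSEQ_unique)
  also have "\<dots> = (\<integral>\<^sup>+\<zeta>. (\<Sum>k. ennreal (U \<zeta>) * ennreal (T k \<zeta>)) \<partial>lborel)"
    by (rule nn_integral_suminf[symmetric]) simp
  finally show ?thesis
    by (simp add: T_def)
qed

text \<open>
  The sets where the absolute series is at most \<open>B\<close> exhaust the ball as \<open>B\<close> grows, and they
  are invariant under \<open>rotate_coord\<close> because rotations do not change the absolute values of
  monomials. So the weight may be cut off to these sets and the cut-off removed by monotone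
  convergence. Working with extended nonnegative integrals keeps the identity valid when both
  sides are infinite.
\<close>

lemma nn_integral_power_series:
  fixes W :: "complex ^ 'm::finite \<Rightarrow> real" and e :: "nat \<Rightarrow> 'm multi_index"
  assumes W: "integrable lborel W" "\<And>\<zeta>. W \<zeta> \<ge> 0"
    and inv: "\<And>j t \<zeta>. W (rotate_coord j t \<zeta>) = W \<zeta>"
    and supp: "\<And>\<zeta>. norm \<zeta> \<ge> 1 \<Longrightarrow> W \<zeta> = 0"
    and f: "has_power_series f c" and e: "bij e"
  shows "(\<integral>\<^sup>+\<zeta>. ennreal (W \<zeta> * (cmod (f \<zeta>))\<^sup>2) \<partial>lborel)
       = (\<Sum>k. ennreal ((cmod (c (e k)))\<^sup>2) *
            (\<integral>\<^sup>+\<zeta>. ennreal (W \<zeta>) * ennreal ((cmod (mi_power \<zeta> (e k)))\<^sup>2) \<partial>lborel))"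
proof -
  have [measurable]: "W \<in> borel_measurable borel"
    using W(1) by auto
  define G where "G \<zeta> = (\<Sum>k. cmod (c (e k) * mi_power \<zeta> (e k)))" for \<zeta>
  define H where "H \<zeta> = (\<Sum>k. ennreal ((cmod (c (e k) * mi_power \<zeta> (e k)))\<^sup>2))" for \<zeta>
  define U where "U B \<zeta> = W \<zeta> * indicator {\<zeta>. G \<zeta> \<le> real B} \<zeta>" for B :: nat and \<zeta>
  have [measurable]: "G \<in> borel_measurable borel" "H \<in> borel_measurable borel"
    unfolding G_def H_def by measurable
  have [measurable]: "U B \<in> borel_measurable borel" for B
    unfolding U_def by measurable
  have [measurable]: "(\<lambda>\<zeta>. indicator (ball 0 1) \<zeta> * f \<zeta>) \<in> borel_measurable borel"
    by (rule measurable_power_series[OF f])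
  have G_inv: "G (rotate_coord j t \<zeta>) = G \<zeta>" for j t \<zeta>
    by (simp add: G_def mi_power_rotate_coord norm_mult)
  have U_nonneg: "U B \<zeta> \<ge> 0" for B \<zeta>
    using W(2) by (simp add: U_def)
  have trunc: "(\<integral>\<^sup>+\<zeta>. ennreal (U B \<zeta> * (cmod (f \<zeta>))\<^sup>2) \<partial>lborel) = (\<integral>\<^sup>+\<zeta>. ennreal (U B \<zeta>) * H \<zeta> \<partial>lborel)" for B
    unfolding H_def
  proof (rule nn_integral_power_series_truncated[where B = "real B"])
    show "integrable lborel (U B)"
      by (rule Bochner_Integration.integrable_bound[OF W(1)]) (auto simp: U_def indicator_def)
    show "U B \<zeta> = 0" if "real B < (\<Sum>k. cmod (c (e k) * mi_power \<zeta> (e k)))" for \<zeta>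
      using that by (simp add: U_def G_def)
  qed (use U_nonneg inv supp f e in \<open>auto simp: U_def G_inv indicator_def\<close>)
  have exhaust: "(\<lambda>B. \<integral>\<^sup>+\<zeta>. ennreal (U B \<zeta>) * \<phi> \<zeta> \<partial>lborel) \<longlonglongrightarrow> (\<integral>\<^sup>+\<zeta>. ennreal (W \<zeta>) * \<phi> \<zeta> \<partial>lborel)"
    if [measurable]: "\<phi> \<in> borel_measurable borel" for \<phi>
  proof (rule nn_integral_LIMSEQ)
    show "incseq (\<lambda>B \<zeta>. ennreal (U B \<zeta>) * \<phi> \<zeta>)"
      using W(2) by (auto simp: incseq_def le_fun_def U_def indicator_def intro!: mult_right_mono)
    show "(\<lambda>B. ennreal (U B \<zeta>) * \<phi> \<zeta>) \<longlonglongrightarrow> ennreal (W \<zeta>) * \<phi> \<zeta>" for \<zeta>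
    proof (rule tendsto_eventually, rule eventually_sequentiallyI)
      fix B assume "B \<ge> nat \<lceil>G \<zeta>\<rceil>"
      hence "G \<zeta> \<le> real B" by linarith
      thus "ennreal (U B \<zeta>) * \<phi> \<zeta> = ennreal (W \<zeta>) * \<phi> \<zeta>"
        by (simp add: U_def)
    qed
  qed measurable
  (* A measurable representative of the squared modulus of f: f itself is arbitrary off the ball. *)
  define \<phi> where "\<phi> \<zeta> = ennreal ((cmod (indicator (ball 0 1) \<zeta> * f \<zeta>))\<^sup>2)" for \<zeta>
  have [measurable]: "\<phi> \<in> borel_measurable borel"
    unfolding \<phi>_def by measurable
  have \<phi>: "ennreal (X * (cmod (f \<zeta>))\<^sup>2) = ennreal X * \<phi> \<zeta>" if "X \<ge> 0" "norm \<zeta> \<ge> 1 \<Longrightarrow> X = 0" for X \<zeta>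
    using that by (cases "norm \<zeta> < 1") (auto simp: \<phi>_def ennreal_mult')
  have W\<phi>: "ennreal (W \<zeta> * (cmod (f \<zeta>))\<^sup>2) = ennreal (W \<zeta>) * \<phi> \<zeta>" for \<zeta>
    using W(2) supp by (intro \<phi>) auto
  have U\<phi>: "ennreal (U B \<zeta> * (cmod (f \<zeta>))\<^sup>2) = ennreal (U B \<zeta>) * \<phi> \<zeta>" for B \<zeta>
    using U_nonneg supp by (intro \<phi>) (auto simp: U_def)
  have "(\<integral>\<^sup>+\<zeta>. ennreal (W \<zeta>) * \<phi> \<zeta> \<partial>lborel) = (\<integral>\<^sup>+\<zeta>. ennreal (W \<zeta>) * H \<zeta> \<partial>lborel)"
    using exhaust[of \<phi>] exhaust[of H] trunc unfolding U\<phi> by (auto intro: LIMSEQ_unique)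
  also have "\<dots> = (\<integral>\<^sup>+\<zeta>. (\<Sum>k. ennreal ((cmod (c (e k)))\<^sup>2) *
        (ennreal (W \<zeta>) * ennreal ((cmod (mi_power \<zeta> (e k)))\<^sup>2))) \<partial>lborel)"
    unfolding H_def
    by (intro nn_integral_cong)
       (simp add: norm_mult power_mult_distrib ennreal_mult' mult.left_commute flip: ennreal_suminf_cmult)
  also have "\<dots> = (\<Sum>k. ennreal ((cmod (c (e k)))\<^sup>2) *
            (\<integral>\<^sup>+\<zeta>. ennreal (W \<zeta>) * ennreal ((cmod (mi_power \<zeta> (e k)))\<^sup>2) \<partial>lborel))"
    by (subst nn_integral_suminf) (simp_all add: nn_integral_cmult)
  finally show ?thesis
    by (simp add: W\<phi>)
qed

text \<open>
  The difference of two expansions is an expansion of 0. By Parseval's identity on the ball its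
  coefficients vanish, since the moments of monomials are positive.
\<close>

lemma has_power_series_unique:
  fixes f :: "complex ^ 'm::finite \<Rightarrow> complex"
  assumes a: "has_power_series f a" and b: "has_power_series f b"
  shows "a = b"
proof
  fix \<alpha> :: "'m multi_index"
  obtain e :: "nat \<Rightarrow> 'm multi_index" where e: "bij e"
    using ex_enum_multi_index by blast
  then obtain k where k: "e k = \<alpha>"
    by (metis bij_pointE)
  have "has_power_series (\<lambda>_. 0) (\<lambda>\<alpha>. a \<alpha> - b \<alpha>)"
    unfolding has_power_series_def
  proof
    fix \<zeta> :: "complex ^ 'm" assume "\<zeta> \<in> ball 0 1"
    hence "((\<lambda>\<alpha>. a \<alpha> * mi_power \<zeta> \<alpha> + - (b \<alpha> * mi_power \<zeta> \<alpha>)) has_sum f \<zeta> + - f \<zeta>) UNIV"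
      using a b unfolding has_power_series_def by (intro has_sum_add has_sum_uminusI) auto
    thus "((\<lambda>\<alpha>. (a \<alpha> - b \<alpha>) * mi_power \<zeta> \<alpha>) has_sum 0) UNIV"
      by (simp add: algebra_simps)
  qed
  note zero = this
  have int: "integrable lborel (indicator (ball 0 1) :: complex ^ 'm \<Rightarrow> real)"
    using emeasure_bounded_finite[of "ball 0 1 :: (complex ^ 'm) set"]
    by (intro integrable_real_indicator) auto
  have inv: "indicator (ball 0 1) (rotate_coord j t \<zeta>) = (indicator (ball 0 1) \<zeta> :: real)"
    for j t and \<zeta> :: "complex ^ 'm"
    by (simp add: indicator_def norm_rotate_coord)
  have *: "(\<integral>\<^sup>+\<zeta>. ennreal (indicator (ball 0 1) \<zeta> * (cmod 0)\<^sup>2) \<partial>(lborel :: (complex ^ 'm) measure))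
       = (\<Sum>k. ennreal ((cmod (a (e k) - b (e k)))\<^sup>2) *
            (\<integral>\<^sup>+\<zeta>. ennreal (indicator (ball 0 1) \<zeta>) * ennreal ((cmod (mi_power \<zeta> (e k)))\<^sup>2) \<partial>lborel))"
    by (rule nn_integral_power_series[OF int _ inv _ zero e]) auto
  define P where "P = pi ^ CARD('m) * mi_fact \<alpha> / fact (CARD('m) + mi_deg \<alpha>)"
  have "a (e k) = b (e k) \<or> ennreal (pi ^ CARD('m) * mi_fact (e k) / fact (CARD('m) + mi_deg (e k))) = 0"
    using * by (simp add: nn_integral_ball_mi_power suminf_eq_zero_iff)
  hence "a \<alpha> = b \<alpha> \<or> ennreal P = 0"
    unfolding P_def k .
  moreover have "P > 0"
    by (auto simp: P_def mi_fact_def intro!: divide_pos_pos mult_pos_pos prod_pos)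
  ultimately show "a \<alpha> = b \<alpha>"
    by (auto simp: ennreal_eq_0_iff)
qed

section \<open>Radial derivatives of power series\<close>

lemma mi_power_update:
  "mi_power (\<chi> i. if i = j then w else \<zeta> $ i) \<alpha> = w ^ \<alpha> j * (\<Prod>i\<in>UNIV - {j}. \<zeta> $ i ^ \<alpha> i)"
  unfolding mi_power_def by (subst prod.remove[of _ j]) (auto intro!: prod.cong)

lemma norm_vec_update_less_1:
  fixes \<zeta> :: "complex ^ 'm::finite"
  assumes "norm \<zeta> < 1" "norm w < sqrt (1 - (norm \<zeta>)\<^sup>2 + (cmod (\<zeta> $ j))\<^sup>2)"
  shows "norm (\<chi> i. if i = j then w else \<zeta> $ i :: complex ^ 'm) < 1"
proof -
  have "(\<Sum>i\<in>UNIV - {j}. (cmod (\<zeta> $ i))\<^sup>2) = (norm \<zeta>)\<^sup>2 - (cmod (\<zeta> $ j))\<^sup>2"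
    unfolding norm_vec_power2 by (subst sum.remove[of UNIV j]) auto
  moreover have "(norm (\<chi> i. if i = j then w else \<zeta> $ i :: complex ^ 'm))\<^sup>2
       = (norm w)\<^sup>2 + (\<Sum>i\<in>UNIV - {j}. (cmod (\<zeta> $ i))\<^sup>2)"
    unfolding norm_vec_power2 by (subst sum.remove[of UNIV j]) (auto intro!: sum.cong)
  moreover have "(norm w)\<^sup>2 < 1 - (norm \<zeta>)\<^sup>2 + (cmod (\<zeta> $ j))\<^sup>2"
  proof -
    have "1 - (norm \<zeta>)\<^sup>2 + (cmod (\<zeta> $ j))\<^sup>2 \<ge> 0"
      using assms(1) by (simp add: abs_square_le_1)
    thus ?thesis
      using power_strict_mono[OF assms(2), of 2] by simp
  qed
  ultimately have "(norm (\<chi> i. if i = j then w else \<zeta> $ i :: complex ^ 'm))\<^sup>2 < 1"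
    by linarith
  thus ?thesis
    by (simp add: abs_square_less_1)
qed

text \<open>
  In the single variable \<open>w = \<zeta>\<^sub>j\<close> the finite partial sums are polynomials that converge
  uniformly on a small disc around \<open>\<zeta>\<^sub>j\<close>, along the net of finite sets of multi-indices; by
  Weierstrass their derivatives converge to the derivative of the limit.
\<close>

lemma has_sum_partial_deriv:
  fixes \<zeta> :: "complex ^ 'm::finite"
  assumes f: "has_power_series f a" and \<zeta>: "norm \<zeta> < 1"
  shows "((\<lambda>\<alpha>. of_nat (\<alpha> j) * (a \<alpha> * mi_power \<zeta> \<alpha>)) has_sum \<zeta> $ j * partial_deriv j f \<zeta>) UNIV"
proof -
  define upd where "upd w = (\<chi> i. if i = j then w else \<zeta> $ i)" for w
  define K where "K \<alpha> = a \<alpha> * (\<Prod>i\<in>UNIV - {j}. \<zeta> $ i ^ \<alpha> i)" for \<alpha>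
  have K: "a \<alpha> * mi_power (upd w) \<alpha> = K \<alpha> * w ^ \<alpha> j" for \<alpha> w
    by (simp add: upd_def mi_power_update K_def mult_ac)
  (* Replacing the j-th coordinate by anything of modulus at most \<rho> keeps the point in the ball,
     so the absolutely convergent series at w = \<rho> majorises the series on the disc of radius r. *)
  have "cmod (\<zeta> $ j) < sqrt (1 - (norm \<zeta>)\<^sup>2 + (cmod (\<zeta> $ j))\<^sup>2)"
    using \<zeta> by (intro real_less_rsqrt) (simp add: abs_square_less_1)
  then obtain \<rho> where \<rho>: "cmod (\<zeta> $ j) < \<rho>" "\<rho> < sqrt (1 - (norm \<zeta>)\<^sup>2 + (cmod (\<zeta> $ j))\<^sup>2)"
    using dense by blast
  have \<rho>0: "\<rho> > 0"
    using \<rho>(1) norm_ge_zero[of "\<zeta> $ j"] by linarith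
  define r where "r = \<rho> - cmod (\<zeta> $ j)"
  have r: "r > 0"
    using \<rho> by (simp add: r_def)
  have le_\<rho>: "cmod w \<le> \<rho>" if "w \<in> cball (\<zeta> $ j) r" for w
    using that norm_triangle_ineq2[of w "\<zeta> $ j"] by (simp add: dist_norm norm_minus_commute r_def)
  have sums: "((\<lambda>\<alpha>. K \<alpha> * w ^ \<alpha> j) has_sum f (upd w)) UNIV" if "cmod w \<le> \<rho>" for w
    using f norm_vec_update_less_1[OF \<zeta>, of w j] that \<rho>
    unfolding has_power_series_def K[symmetric] by (auto simp: upd_def)
  have ulim: "uniform_limit (cball (\<zeta> $ j) r) (\<lambda>X w. \<Sum>\<alpha>\<in>X. K \<alpha> * w ^ \<alpha> j) (\<lambda>w. f (upd w))
      (finite_subsets_at_top UNIV)"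
  proof (rule Weierstrass_m_test_general')
    show "(\<lambda>\<alpha>. cmod (K \<alpha> * of_real \<rho> ^ \<alpha> j)) summable_on UNIV"
      using sums[of "of_real \<rho>"] \<rho>0
      by (auto simp: summable_on_iff_abs_summable_on_complex[symmetric] summable_on_def)
    show "cmod (K \<alpha> * w ^ \<alpha> j) \<le> cmod (K \<alpha> * of_real \<rho> ^ \<alpha> j)" if "w \<in> cball (\<zeta> $ j) r" for \<alpha> w
      using le_\<rho>[OF that] \<rho>0 by (auto simp: norm_mult norm_power intro!: mult_left_mono power_mono)
  qed (use sums le_\<rho> in auto)
  obtain g' where g': "\<And>w. w \<in> ball (\<zeta> $ j) r \<Longrightarrow> ((\<lambda>w. f (upd w)) has_field_derivative g' w) (at w) \<and>
      ((\<lambda>X. \<Sum>\<alpha>\<in>X. K \<alpha> * (of_nat (\<alpha> j) * w ^ (\<alpha> j - 1))) \<longlongrightarrow> g' w) (finite_subsets_at_top UNIV)"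
  proof (rule has_complex_derivative_uniform_limit[OF _ ulim _ r])
    show "\<forall>\<^sub>F X in finite_subsets_at_top UNIV.
       continuous_on (cball (\<zeta> $ j) r) (\<lambda>w. \<Sum>\<alpha>\<in>X. K \<alpha> * w ^ \<alpha> j) \<and>
       (\<forall>w\<in>ball (\<zeta> $ j) r. ((\<lambda>w. \<Sum>\<alpha>\<in>X. K \<alpha> * w ^ \<alpha> j) has_field_derivative
            (\<Sum>\<alpha>\<in>X. K \<alpha> * (of_nat (\<alpha> j) * w ^ (\<alpha> j - 1)))) (at w))"
      by (intro always_eventually allI conjI ballI continuous_intros)
         (auto intro!: derivative_eq_intros sum.cong)
  qed auto
  have "partial_deriv j f \<zeta> = g' (\<zeta> $ j)"
    using g'[of "\<zeta> $ j"] r unfolding partial_deriv_def by (auto simp: upd_def intro!: DERIV_imp_deriv)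
  hence "((\<lambda>\<alpha>. K \<alpha> * (of_nat (\<alpha> j) * (\<zeta> $ j) ^ (\<alpha> j - 1))) has_sum partial_deriv j f \<zeta>) UNIV"
    using g'[of "\<zeta> $ j"] r by (simp add: has_sum_def)
  hence "((\<lambda>\<alpha>. \<zeta> $ j * (K \<alpha> * (of_nat (\<alpha> j) * (\<zeta> $ j) ^ (\<alpha> j - 1)))) has_sum \<zeta> $ j * partial_deriv j f \<zeta>) UNIV"
    by (rule has_sum_cmult_right)
  also have "(\<lambda>\<alpha>. \<zeta> $ j * (K \<alpha> * (of_nat (\<alpha> j) * (\<zeta> $ j) ^ (\<alpha> j - 1))))
      = (\<lambda>\<alpha>. of_nat (\<alpha> j) * (a \<alpha> * mi_power \<zeta> \<alpha>))"
  proof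
    fix \<alpha> :: "'m multi_index"
    have "upd (\<zeta> $ j) = \<zeta>"
      by (simp add: upd_def vec_eq_iff)
    hence "a \<alpha> * mi_power \<zeta> \<alpha> = K \<alpha> * (\<zeta> $ j) ^ \<alpha> j"
      using K[of \<alpha> "\<zeta> $ j"] by simp
    thus "\<zeta> $ j * (K \<alpha> * (of_nat (\<alpha> j) * (\<zeta> $ j) ^ (\<alpha> j - 1))) = of_nat (\<alpha> j) * (a \<alpha> * mi_power \<zeta> \<alpha>)"
      by (cases "\<alpha> j") auto
  qed
  finally show ?thesis .
qed

lemma has_power_series_radial_deriv:
  assumes "has_power_series f a"
  shows "has_power_series (radial_deriv f) (\<lambda>\<alpha>. of_nat (mi_deg \<alpha>) * a \<alpha>)"
  unfolding has_power_series_def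
proof
  fix \<zeta> :: "complex ^ 'a" assume "\<zeta> \<in> ball 0 1"
  hence *: "((\<lambda>\<alpha>. of_nat (\<alpha> j) * (a \<alpha> * mi_power \<zeta> \<alpha>)) has_sum \<zeta> $ j * partial_deriv j f \<zeta>) UNIV" for j
    using has_sum_partial_deriv[OF assms] by simp
  have "((\<lambda>\<alpha>. \<Sum>j\<in>UNIV. of_nat (\<alpha> j) * (a \<alpha> * mi_power \<zeta> \<alpha>)) has_sum radial_deriv f \<zeta>) UNIV"
  proof -
    have swap: "(\<lambda>X. \<Sum>\<alpha>\<in>X. \<Sum>j\<in>UNIV. of_nat (\<alpha> j) * (a \<alpha> * mi_power \<zeta> \<alpha>))
        = (\<lambda>X. \<Sum>j\<in>UNIV. \<Sum>\<alpha>\<in>X. of_nat (\<alpha> j) * (a \<alpha> * mi_power \<zeta> \<alpha>))"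
      by (intro ext sum.swap)
    from * show ?thesis
      unfolding radial_deriv_def has_sum_def swap by (intro tendsto_sum)
  qed
  thus "((\<lambda>\<alpha>. of_nat (mi_deg \<alpha>) * a \<alpha> * mi_power \<zeta> \<alpha>) has_sum radial_deriv f \<zeta>) UNIV"
    by (simp add: mi_deg_def sum_distrib_right mult.assoc)
qed

text \<open>
  Each factor \<open>1 + m/k\<close> raises \<open>(m + k - 1 choose k - 1)\<close> to \<open>(m + k choose k)\<close>.
\<close>

lemma has_power_series_radial_op:
  assumes "has_power_series f a"
  shows "has_power_series (radial_op k f) (\<lambda>\<alpha>. of_nat ((mi_deg \<alpha> + k) choose k) * a \<alpha>)"
proof (induction k)
  case 0
  show ?case using assms by simp
next
  case (Suc k)
  have coeff: "of_nat ((m + k) choose k) + of_nat m * of_nat ((m + k) choose k) / of_nat (Suc k)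
      = (of_nat ((m + Suc k) choose Suc k) :: complex)" for m
  proof -
    have "of_nat (Suc k) * of_nat ((m + Suc k) choose Suc k)
            = (of_nat (Suc (m + k)) * of_nat ((m + k) choose k) :: complex)"
      using Suc_times_binomial_eq[of "m + k" k] by (simp only: of_nat_mult[symmetric] mult.commute add_Suc_right)
    thus ?thesis
      by (simp add: field_simps del: binomial_Suc_Suc of_nat_Suc) (simp add: algebra_simps)
  qed
  show ?case
    unfolding has_power_series_def
  proof
    fix \<zeta> :: "complex ^ 'a" assume \<zeta>: "\<zeta> \<in> ball 0 1"
    let ?b = "\<lambda>\<alpha>. of_nat ((mi_deg \<alpha> + k) choose k) * a \<alpha>"
    have "((\<lambda>\<alpha>. ?b \<alpha> * mi_power \<zeta> \<alpha> + of_nat (mi_deg \<alpha>) * ?b \<alpha> * mi_power \<zeta> \<alpha> * (1 / of_nat (Suc k)))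
        has_sum radial_op k f \<zeta> + radial_deriv (radial_op k f) \<zeta> * (1 / of_nat (Suc k))) UNIV"
      using Suc has_power_series_radial_deriv[OF Suc] \<zeta> unfolding has_power_series_def
      by (intro has_sum_add has_sum_cmult_left) auto
    also have "(\<lambda>\<alpha>. ?b \<alpha> * mi_power \<zeta> \<alpha> + of_nat (mi_deg \<alpha>) * ?b \<alpha> * mi_power \<zeta> \<alpha> * (1 / of_nat (Suc k)))
      = (\<lambda>\<alpha>. of_nat ((mi_deg \<alpha> + Suc k) choose Suc k) * a \<alpha> * mi_power \<zeta> \<alpha>)"
    proof
      fix \<alpha> :: "'a multi_index"
      have "x * A * P + m * (x * A) * P * (1 / s) = (x + m * x / s) * A * P" for x A P m s :: complex
        by (simp add: algebra_simps)
      thus "?b \<alpha> * mi_power \<zeta> \<alpha> + of_nat (mi_deg \<alpha>) * ?b \<alpha> * mi_power \<zeta> \<alpha> * (1 / of_nat (Suc k))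
          = of_nat ((mi_deg \<alpha> + Suc k) choose Suc k) * a \<alpha> * mi_power \<zeta> \<alpha>"
        unfolding coeff[symmetric] .
    qed
    finally show "((\<lambda>\<alpha>. of_nat ((mi_deg \<alpha> + Suc k) choose Suc k) * a \<alpha> * mi_power \<zeta> \<alpha>)
        has_sum radial_op (Suc k) f \<zeta>) UNIV"
      by simp
  qed
qed

section \<open>The norm formula\<close>

text \<open>
  The indicator is built into the weight so that integrals over the ball become integrals over
  the whole space. At the origin the quotient is \<open>0\<close> by convention, which concerns a null set
  only.
\<close>

definition DA_weight :: "nat \<Rightarrow> complex ^ 'm::finite \<Rightarrow> real" where
  "DA_weight n \<zeta> = indicator (ball 0 1) \<zeta> * ((1 - (norm \<zeta>)\<^sup>2) ^ (n - 1) / norm \<zeta> ^ (2 * n))"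

lemma DA_weight_nonneg: "DA_weight n \<zeta> \<ge> 0"
  by (auto simp: DA_weight_def indicator_def abs_square_le_1 intro!: mult_nonneg_nonneg divide_nonneg_nonneg zero_le_power)

lemma measurable_DA_weight [measurable]: "DA_weight n \<in> borel_measurable borel"
  unfolding DA_weight_def[abs_def]
  by (intro borel_measurable_times borel_measurable_indicator borel_measurable_divide
      borel_measurable_power borel_measurable_diff borel_measurable_const borel_measurable_norm) auto

text \<open>
  The factor \<open>|\<zeta>|\<^sup>-\<^sup>2\<^sup>n\<close> cancels the power of the radial density that comes from the dimension,
  and leaves the Beta integral of \<open>t\<^sup>m (1 - t)\<^sup>n\<^sup>-\<^sup>1\<close>.
\<close>

lemma nn_integral_DA_weight_mi_power:
  fixes \<alpha> :: "'m::finite multi_index"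
  assumes "n \<ge> 1" and card: "CARD('m) = n + 1"
  defines "m \<equiv> mi_deg \<alpha>"
  shows "(\<integral>\<^sup>+\<zeta>. ennreal (DA_weight n \<zeta>) * ennreal ((cmod (mi_power \<zeta> \<alpha>))\<^sup>2) \<partial>lborel)
     = ennreal (pi ^ (n + 1) * mi_fact \<alpha> * fact m * fact (n - 1) / (fact (m + n))\<^sup>2)"
proof -
  define F where "F t = ennreal (indicator {..<1} t * ((1 - t) ^ (n - 1) / t ^ n))" for t :: real
  define C where "C = pi ^ (n + 1) * mi_fact \<alpha> / fact (n + m)"
  have [measurable]: "F \<in> borel_measurable borel"
    unfolding F_def by measurable
  have C: "C \<ge> 0"
    by (auto simp: C_def mi_fact_def intro!: divide_nonneg_nonneg mult_nonneg_nonneg prod_nonneg)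
  have "ennreal (DA_weight n \<zeta>) = F ((norm \<zeta>)\<^sup>2)" for \<zeta> :: "complex ^ 'm"
    by (auto simp: DA_weight_def F_def indicator_def power_mult abs_square_less_1)
  hence "(\<integral>\<^sup>+\<zeta>. ennreal (DA_weight n \<zeta>) * ennreal ((cmod (mi_power \<zeta> \<alpha>))\<^sup>2) \<partial>lborel)
     = (\<integral>\<^sup>+t. F t * (ennreal (C * t ^ (n + m)) * indicator {0..} t) \<partial>lborel)"
    using nn_integral_radial_mi_power[of F \<alpha>] by (simp add: card m_def C_def)
  also have "\<dots> = (\<integral>\<^sup>+t. ennreal C * (ennreal (t ^ m * (1 - t) ^ (n - 1)) * indicator {0..1} t) \<partial>lborel)"
    using C by (intro nn_integral_cong_AE eventually_mono[OF eventually_conj[OF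
            AE_lborel_singleton[of 0] AE_lborel_singleton[of 1]]])
      (auto simp: F_def indicator_def power_add ennreal_mult'[symmetric] mult_ac)
  also have "\<dots> = ennreal C * ennreal (fact m * fact (n - 1) / fact (m + n))"
    using assms(1) nn_integral_Beta_nat[of m "n - 1"] by (subst nn_integral_cmult) simp_all
  also have "\<dots> = ennreal (pi ^ (n + 1) * mi_fact \<alpha> * fact m * fact (n - 1) / (fact (m + n))\<^sup>2)"
    using C by (simp add: ennreal_mult'[symmetric] C_def power2_eq_square add.commute mult_ac)
  finally show ?thesis .
qed

lemma DA_weight_rotate_coord: "DA_weight n (rotate_coord j t \<zeta>) = DA_weight n \<zeta>"
  by (simp add: DA_weight_def norm_rotate_coord indicator_def)

text \<open>The total mass of the weight is its moment for \<open>\<alpha> = 0\<close>.\<close>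

lemma integrable_DA_weight:
  assumes "n \<ge> 1" "CARD('m) = n + 1"
  shows "integrable lborel (DA_weight n :: complex ^ 'm::finite \<Rightarrow> real)"
proof (rule integrableI_nonneg)
  have "(\<integral>\<^sup>+\<zeta>. ennreal (DA_weight n \<zeta>) \<partial>(lborel :: (complex ^ 'm) measure)) =
      (\<integral>\<^sup>+\<zeta>. ennreal (DA_weight n \<zeta>) * ennreal ((cmod (mi_power \<zeta> (\<lambda>_::'m. 0)))\<^sup>2) \<partial>lborel)"
    by (simp add: mi_power_def)
  also have "\<dots> < \<infinity>"
    by (subst nn_integral_DA_weight_mi_power[OF assms]) simp
  finally show "(\<integral>\<^sup>+\<zeta>. ennreal (DA_weight n \<zeta>) \<partial>(lborel :: (complex ^ 'm) measure)) < \<infinity>" .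
qed (auto simp: DA_weight_nonneg)

lemma nn_integral_DA_weight_power_series:
  fixes e :: "nat \<Rightarrow> 'm::finite multi_index"
  assumes n: "n \<ge> 1" and card: "CARD('m) = n + 1"
    and f: "has_power_series f c" and e: "bij e"
  shows "(\<integral>\<^sup>+\<zeta>. ennreal (DA_weight n \<zeta> * (cmod (f \<zeta>))\<^sup>2) \<partial>lborel)
       = (\<Sum>k. ennreal ((cmod (c (e k)))\<^sup>2 * (pi ^ (n + 1) * mi_fact (e k) * fact (mi_deg (e k)) * fact (n - 1)
              / (fact (mi_deg (e k) + n))\<^sup>2)))"
proof -
  have supp: "DA_weight n \<zeta> = 0" if "norm \<zeta> \<ge> 1" for \<zeta> :: "complex ^ 'm"
    using that by (simp add: DA_weight_def)
  show ?thesis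
    using nn_integral_power_series[OF integrable_DA_weight[OF n card] DA_weight_nonneg
        DA_weight_rotate_coord supp f e]
    by (simp add: nn_integral_DA_weight_mi_power[OF n card] flip: ennreal_mult')
qed

theorem theorem6p1:
  fixes n :: nat and f :: "complex ^ 'm::finite \<Rightarrow> complex"
  assumes "n \<ge> 1" and "CARD('m) = n + 1"
    and "f \<in> DA_space"
  shows "set_integrable lborel (ball 0 1)
           (\<lambda>\<zeta>::complex ^ 'm. (1 - (norm \<zeta>)\<^sup>2) ^ (n - 1) / norm \<zeta> ^ (2 * n)
              * (cmod (radial_op n f \<zeta>))\<^sup>2)
       \<and> (DA_norm f)\<^sup>2 = real n * (fact n / pi ^ (n + 1)) *
           (LINT \<zeta>:ball 0 1|lborel. (1 - (norm \<zeta>)\<^sup>2) ^ (n - 1) / norm \<zeta> ^ (2 * n)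
              * (cmod (radial_op n f \<zeta>))\<^sup>2)"
proof -
  obtain a where a: "has_power_series f a"
    using assms(3) by (auto simp: DA_space_def)
  hence coeffs: "coeffs_of f = a"
    unfolding coeffs_of_def using has_power_series_unique by (intro the_equality) auto
  obtain e :: "nat \<Rightarrow> 'm multi_index" where e: "bij e"
    using ex_enum_multi_index by blast
  (* The reciprocal of the constant in front of the integral. *)
  define D where "D = pi ^ (n + 1) / (real n * fact n)"
  define g where "g = radial_op n f"
  have g: "has_power_series g (\<lambda>\<alpha>. of_nat ((mi_deg \<alpha> + n) choose n) * a \<alpha>)"
    unfolding g_def using a by (rule has_power_series_radial_op)
  have DA_nonneg: "DA_term f \<alpha> \<ge> 0" for \<alpha>
    by (auto simp: DA_term_def mi_fact_def intro!: mult_nonneg_nonneg divide_nonneg_nonneg prod_nonneg)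
  have "(DA_term f has_sum (\<Sum>\<^sub>\<infinity>\<alpha>. DA_term f \<alpha>)) UNIV"
    using assms(3) by (intro has_sum_infsum) (auto simp: DA_space_def)
  moreover have "(\<Sum>\<^sub>\<infinity>\<alpha>. DA_term f \<alpha>) = (DA_norm f)\<^sup>2"
    using DA_nonneg by (simp add: DA_norm_def infsum_nonneg)
  ultimately have "((\<lambda>k. DA_term f (e k)) has_sum (DA_norm f)\<^sup>2) UNIV"
    using has_sum_reindex_bij_betw[OF e, of "DA_term f"] by simp
  hence sums: "(\<lambda>k. DA_term f (e k) * D) sums ((DA_norm f)\<^sup>2 * D)"
    by (intro sums_mult2 has_sum_imp_sums)
  (* The squared binomial coefficient cancels the squared factorial in the moment. *)
  have term_eq: "(cmod (of_nat ((m + n) choose n) * a \<alpha>))\<^sup>2 *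
        (pi ^ (n + 1) * mi_fact \<alpha> * fact m * fact (n - 1) / (fact (m + n))\<^sup>2) = DA_term f \<alpha> * D"
    if m: "m = mi_deg \<alpha>" for \<alpha> m
  proof -
    have choose: "fact (m + n) = real ((m + n) choose n) * (real n * fact (n - 1) * fact m)"
      using assms(1) by (simp add: binomial_fact fact_reduce[of n])
    have "(B * A)\<^sup>2 * (p * M * s * q / (B * (N * q * s))\<^sup>2) = M / s * A\<^sup>2 * (p / (N * (N * q)))"
      if "B \<noteq> 0" "q \<noteq> 0" "s \<noteq> 0" "N \<noteq> 0" for A B M N p q s :: real
      using that by (simp add: power2_eq_square field_simps)
    from this[of "real ((m + n) choose n)" "fact (n - 1)" "fact m" "real n"] assms(1)
    show ?thesis
      by (simp add: norm_mult DA_term_def coeffs D_def m[symmetric] choose fact_reduce[of n])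
  qed
  have nn: "(\<integral>\<^sup>+\<zeta>. ennreal (DA_weight n \<zeta> * (cmod (g \<zeta>))\<^sup>2) \<partial>lborel) = ennreal ((DA_norm f)\<^sup>2 * D)"
    unfolding nn_integral_DA_weight_power_series[OF assms(1,2) g e] term_eq[OF refl]
    using sums DA_nonneg by (intro suminf_ennreal_eq) (auto simp: D_def)
  have eq: "DA_weight n \<zeta> * (cmod (g \<zeta>))\<^sup>2 = indicator (ball 0 1) \<zeta> *\<^sub>R
        ((1 - (norm \<zeta>)\<^sup>2) ^ (n - 1) / norm \<zeta> ^ (2 * n) * (cmod (g \<zeta>))\<^sup>2)" for \<zeta>
    by (simp add: DA_weight_def)
  have meas: "(\<lambda>\<zeta>. DA_weight n \<zeta> * (cmod (g \<zeta>))\<^sup>2) \<in> borel_measurable borel"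
  proof -
    have [measurable]: "(\<lambda>\<zeta>. indicator (ball 0 1) \<zeta> * g \<zeta>) \<in> borel_measurable borel"
      by (rule measurable_power_series[OF g])
    have "(\<lambda>\<zeta>. DA_weight n \<zeta> * (cmod (g \<zeta>))\<^sup>2)
        = (\<lambda>\<zeta>. DA_weight n \<zeta> * (cmod (indicator (ball 0 1) \<zeta> * g \<zeta>))\<^sup>2)"
      by (auto simp: fun_eq_iff DA_weight_def indicator_def)
    thus ?thesis by simp
  qed
  have "has_bochner_integral lborel (\<lambda>\<zeta>. DA_weight n \<zeta> * (cmod (g \<zeta>))\<^sup>2) ((DA_norm f)\<^sup>2 * D)"
    using meas nn
    by (intro has_bochner_integral_nn_integral) (auto simp: DA_weight_nonneg D_def)
  hence "set_integrable lborel (ball 0 1)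
           (\<lambda>\<zeta>. (1 - (norm \<zeta>)\<^sup>2) ^ (n - 1) / norm \<zeta> ^ (2 * n) * (cmod (g \<zeta>))\<^sup>2)"
    and "(LINT \<zeta>:ball 0 1|lborel. (1 - (norm \<zeta>)\<^sup>2) ^ (n - 1) / norm \<zeta> ^ (2 * n) * (cmod (g \<zeta>))\<^sup>2)
           = (DA_norm f)\<^sup>2 * D"
    unfolding eq set_integrable_def set_lebesgue_integral_def by (simp_all add: has_bochner_integral_iff)
  moreover have "real n * (fact n / pi ^ (n + 1)) * ((DA_norm f)\<^sup>2 * D) = (DA_norm f)\<^sup>2"
    using assms(1) by (simp add: D_def)
  ultimately show ?thesis
    by (simp add: g_def)
qed

end
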